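(* Let $\mathcal{A}$ be a category with coequalizers, let $(L,R,\eta,\epsilon)$ be an adjunction with $R:\mathcal{A}\to\mathcal{B}$, and let $n\in\mathbb{N}$. The functor $\Lambda_n:\mathcal{B}_n\to\mathcal{B}_{[n]}$ from the $n$-th category of the monadic tower of $(L,R)$ to the $n$-th category of the adjoint decomposition of $(L,R)$ is an $\mathsf{M}(U_{[n]})$-fibration, where $\mathsf{M}(U_{[n]})$ is the class of morphisms $f$ of $\mathcal{B}_{[n]}$ such that $U_{[n]}f$ is a monomorphism in $\mathcal{B}$. Moreover $\Lambda_n$ is a discrete isofibration and $\mathrm{Eim}(\Lambda_n)=\mathrm{Im}(\Lambda_n)=\mathrm{Im}'(\Lambda_n)$.
   Context: Whiskering of a natural transformation by functors is written $F\alpha$, $\alpha G$. Coequalizers in $\mathcal{A}$ are fixed once and for all. Fibration notions. Let $F:\mathcal{C}\to\mathcal{D}$ be a functor. A morphism $f$ of $\mathcal{C}$ is cartesian (with respect to $F$) over a morphism $f'$ of $\mathcal{D}$ if $Ff=f'$ and, for all $g\in\mathcal{C}$ with the same codomain as $f$ and $h\in\mathcal{D}$ with $Ff\circ h=Fg$, there is a unique $k\in\mathcal{C}$ with $Fk=h$ and $f\circ k=g$. For a class $\mathsf{M}$ of morphisms of $\mathcal{D}$, $F$ is an $\mathsf{M}$-fibration if for every $C\in\mathcal{C}$ and every $f':D\to FC$ in $\mathsf{M}$ there is $f:C'\to C$ cartesian over $f'$. $F$ is an isofibration if for every $C\in\mathcal{C}$ and every isomorphism $f':D\to FC$ there is an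 isomorphism $f:C'\to C$ with $Ff=f'$; it is a discrete isofibration if moreover $f$ is unique. $\mathrm{Im}(F)$ consists of the objects $FC$ and the morphisms $Ff$; $\mathrm{Im}'(F)$ is the full subcategory of $\mathcal{D}$ on the objects $FC$; $\mathrm{Eim}(F)$ is the full subcategory of $\mathcal{D}$ on the objects isomorphic to some $FC$. Adjoint decomposition of $(L,R,\eta,\epsilon)$. Define recursively categories $\mathcal{B}_{[n]}$, functors $U_{[n]}:\mathcal{B}_{[n]}\to\mathcal{B}$, adjunctions $(L_{[n]},R_{[n]},\eta_{[n]},\epsilon_{[n]})$ with $R_{[n]}:\mathcal{A}\to\mathcal{B}_{[n]}$ and $U_{[n]}R_{[n]}=R$, and natural transformations $\pi_{[n]}:LU_{[n]}\to L_{[n]}$. For $n=0$: $\mathcal{B}_{[0]}=\mathcal{B}$, $U_{[0]}=\mathrm{Id}$, $(L_{[0]},R_{[0]},\eta_{[0]},\epsilon_{[0]})=(L,R,\eta,\epsilon)$, $\pi_{[0]}=\mathrm{Id}_L$. Given stage $n$: - objects of $\mathcal{B}_{[n+1]}$ are pairs $(B_{[n]},b_{[n]})$ with $B_{[n]}\in\mathcal{B}_{[n]}$ and $b_{[n]}:RL_{[n]}B_{[n]}\to U_{[n]}B_{[n]}$ any morphism in $\mathcal{B}$; morphisms $(B_{[n]},b_{[n]})\to(B'_{[n]},b'_{[n]})$ are morphisms $f:B_{[n]}\to B'_{[n]}$ in $\mathcal{B}_{[n]}$ with $U_{[n]}f\circ b_{[n]}=b'_{[n]}\circ RL_{[n]}f$;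 $U_{[n,n+1]}:\mathcal{B}_{[n+1]}\to\mathcal{B}_{[n]}$ is the forgetful functor and $U_{[n+1]}=U_{[n]}U_{[n,n+1]}$; - $R_{[n+1]}A=(R_{[n]}A,R\epsilon_{[n]}A)$, $R_{[n+1]}f=R_{[n]}f$; - $\pi_{[n,n+1]}B_{[n+1]}:L_{[n]}B_{[n]}\to L_{[n+1]}B_{[n+1]}$ is the coequalizer of $\pi_{[n]}B_{[n]}\circ Lb_{[n]}$ and $\epsilon L_{[n]}B_{[n]}$, both from $LRL_{[n]}B_{[n]}$ to $L_{[n]}B_{[n]}$, where $B_{[n+1]}=(B_{[n]},b_{[n]})$; $\pi_{[n+1]}=\pi_{[n,n+1]}\circ\pi_{[n]}U_{[n,n+1]}$; - the unit and counit of $(L_{[n+1]},R_{[n+1]})$ are determined by $U_{[n,n+1]}\eta_{[n+1]}=R_{[n]}\pi_{[n,n+1]}\circ\eta_{[n]}U_{[n,n+1]}$ and $\epsilon_{[n+1]}\circ\pi_{[n,n+1]}R_{[n+1]}=\epsilon_{[n]}$. Monadic tower of $(L,R)$. $\mathcal{B}_0=\mathcal{B}$, $(L_0,R_0,\eta_0,\epsilon_0)=(L,R,\eta,\epsilon)$. Given $(L_n,R_n,\eta_n,\epsilon_n)$ with $R_n:\mathcal{A}\to\mathcal{B}_n$: $\mathcal{B}_{n+1}$ is the Eilenberg-Moore category of the monad $(R_nL_n,R_n\epsilon_nL_n,\eta_n)$ on $\mathcal{B}_n$, $U_{n,n+1}:\mathcal{B}_{n+1}\to\mathcal{B}_n$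 is the forgetful functor, $R_{n+1}:\mathcal{A}\to\mathcal{B}_{n+1}$, $A\mapsto(R_nA,R_n\epsilon_nA)$, is the comparison functor, and $L_{n+1}$ is its left adjoint, with $L_{n+1}(B_n,\mu_n)$ the coequalizer of $L_n\mu_n,\epsilon_nL_nB_n:L_nR_nL_nB_n\to L_nB_n$; unit and counit $\eta_{n+1},\epsilon_{n+1}$. $U_n:\mathcal{B}_n\to\mathcal{B}$ is the composite of forgetful functors. The functors $\Lambda_n:\mathcal{B}_n\to\mathcal{B}_{[n]}$ are defined recursively, together with natural isomorphisms $\lambda_n:=\epsilon_{[n]}L_n\circ L_{[n]}\Lambda_n\eta_n:L_{[n]}\Lambda_n\to L_n$ (one has $\Lambda_nR_n=R_{[n]}$): $\Lambda_0=\mathrm{Id}$, and $\Lambda_{n+1}(V_n,\mu_n)=(\Lambda_nV_n,\;U_n\mu_n\circ R\lambda_nV_n)$, $U_{[n,n+1]}\Lambda_{n+1}f=\Lambda_nU_{n,n+1}f$. Each $\Lambda_n$ is fully faithful and injective on objects. *)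

theory Defs
  imports Main
begin

section \<open>Categories, functors, adjunctions\<close>

record ('o, 'm) category =
  Obj :: "'o set"
  Arr :: "'m set"
  Dom :: "'m \<Rightarrow> 'o"
  Cod :: "'m \<Rightarrow> 'o"
  Ide :: "'o \<Rightarrow> 'm"
  Comp :: "'m \<Rightarrow> 'm \<Rightarrow> 'm"  (infixr "\<cdot>\<index>" 70)

definition hom :: "('o, 'm) category \<Rightarrow> 'o \<Rightarrow> 'o \<Rightarrow> 'm set" where
  "hom C x y = {f \<in> Arr C. Dom C f = x \<and> Cod C f = y}"

locale category =
  fixes C :: "('o, 'm) category" (structure)
  assumes dom_obj: "f \<in> Arr C \<Longrightarrow> Dom C f \<in> Obj C"
    and cod_obj: "f \<in> Arr C \<Longrightarrow> Cod C f \<in> Obj C"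
    and ide_hom: "x \<in> Obj C \<Longrightarrow> Ide C x \<in> hom C x x"
    and comp_hom: "f \<in> hom C x y \<Longrightarrow> g \<in> hom C y z \<Longrightarrow> g \<cdot> f \<in> hom C x z"
    and comp_ide: "f \<in> hom C x y \<Longrightarrow> f \<cdot> Ide C x = f"
    and ide_comp: "f \<in> hom C x y \<Longrightarrow> Ide C y \<cdot> f = f"
    and comp_assoc: "f \<in> hom C w x \<Longrightarrow> g \<in> hom C x y \<Longrightarrow> h \<in> hom C y z \<Longrightarrow>
      (h \<cdot> g) \<cdot> f = h \<cdot> (g \<cdot> f)"

definition monomorphism :: "('o, 'm) category \<Rightarrow> 'm \<Rightarrow> bool" where
  "monomorphism C f \<longleftrightarrow> f \<in> Arr C \<and>
    (\<forall>x. \<forall>g \<in> hom C x (Dom C f). \<forall>h \<in> hom C x (Dom C f).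
       f \<cdot>\<^bsub>C\<^esub> g = f \<cdot>\<^bsub>C\<^esub> h \<longrightarrow> g = h)"

definition isomorphism :: "('o, 'm) category \<Rightarrow> 'm \<Rightarrow> bool" where
  "isomorphism C f \<longleftrightarrow> f \<in> Arr C \<and>
    (\<exists>g \<in> hom C (Cod C f) (Dom C f).
       g \<cdot>\<^bsub>C\<^esub> f = Ide C (Dom C f) \<and> f \<cdot>\<^bsub>C\<^esub> g = Ide C (Cod C f))"

definition isomorphic :: "('o, 'm) category \<Rightarrow> 'o \<Rightarrow> 'o \<Rightarrow> bool" where
  "isomorphic C x y \<longleftrightarrow> (\<exists>f \<in> hom C x y. isomorphism C f)"

definition coequalizer :: "('o, 'm) category \<Rightarrow> 'm \<Rightarrow> 'm \<Rightarrow> 'm \<Rightarrow> bool" where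
  "coequalizer C f g q \<longleftrightarrow>
    f \<in> Arr C \<and> g \<in> hom C (Dom C f) (Cod C f) \<and> q \<in> Arr C \<and> Dom C q = Cod C f \<and>
    q \<cdot>\<^bsub>C\<^esub> f = q \<cdot>\<^bsub>C\<^esub> g \<and>
    (\<forall>z. \<forall>h \<in> hom C (Cod C f) z. h \<cdot>\<^bsub>C\<^esub> f = h \<cdot>\<^bsub>C\<^esub> g \<longrightarrow>
       (\<exists>!k. k \<in> hom C (Cod C q) z \<and> k \<cdot>\<^bsub>C\<^esub> q = h))"

definition chosen_coequalizers :: "('o, 'm) category \<Rightarrow> ('m \<Rightarrow> 'm \<Rightarrow> 'm) \<Rightarrow> bool" where
  "chosen_coequalizers C coeq \<longleftrightarrow>
    (\<forall>x y. \<forall>f \<in> hom C x y. \<forall>g \<in> hom C x y. coequalizer C f g (coeq f g))"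

record ('o, 'm, 'p, 'n) functr =
  omap :: "'o \<Rightarrow> 'p"
  amap :: "'m \<Rightarrow> 'n"

definition fcomp :: "('p, 'n, 'q, 'k) functr \<Rightarrow> ('o, 'm, 'p, 'n) functr \<Rightarrow> ('o, 'm, 'q, 'k) functr"
  (infixr "\<circ>\<^sub>F" 70) where
  "G \<circ>\<^sub>F F = \<lparr>omap = omap G \<circ> omap F, amap = amap G \<circ> amap F\<rparr>"

definition fident :: "('o, 'm, 'o, 'm) functr" where
  "fident = \<lparr>omap = (\<lambda>x. x), amap = (\<lambda>f. f)\<rparr>"

locale is_functor =
  dom: category C + cod: category D
  for C :: "('o, 'm) category" and D :: "('p, 'n) category" +
  fixes F :: "('o, 'm, 'p, 'n) functr"
  assumes omap_obj: "x \<in> Obj C \<Longrightarrow> omap F x \<in> Obj D"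
    and amap_hom: "f \<in> hom C x y \<Longrightarrow> amap F f \<in> hom D (omap F x) (omap F y)"
    and amap_ide: "x \<in> Obj C \<Longrightarrow> amap F (Ide C x) = Ide D (omap F x)"
    and amap_comp: "f \<in> hom C x y \<Longrightarrow> g \<in> hom C y z \<Longrightarrow>
      amap F (g \<cdot>\<^bsub>C\<^esub> f) = amap F g \<cdot>\<^bsub>D\<^esub> amap F f"

definition natural_transformation ::
  "('o, 'm) category \<Rightarrow> ('p, 'n) category \<Rightarrow> ('o, 'm, 'p, 'n) functr \<Rightarrow>
   ('o, 'm, 'p, 'n) functr \<Rightarrow> ('o \<Rightarrow> 'n) \<Rightarrow> bool" where
  "natural_transformation C D F G \<alpha> \<longleftrightarrow>
    (\<forall>x \<in> Obj C. \<alpha> x \<in> hom D (omap F x) (omap G x)) \<and>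
    (\<forall>x y. \<forall>f \<in> hom C x y. \<alpha> y \<cdot>\<^bsub>D\<^esub> amap F f = amap G f \<cdot>\<^bsub>D\<^esub> \<alpha> x)"

record ('ao, 'am, 'bo, 'bm) adjn =
  ladj :: "('bo, 'bm, 'ao, 'am) functr"
  radj :: "('ao, 'am, 'bo, 'bm) functr"
  unit :: "'bo \<Rightarrow> 'bm"
  counit :: "'ao \<Rightarrow> 'am"

locale adjunction =
  left: is_functor B A "ladj S" + right: is_functor A B "radj S"
  for A :: "('ao, 'am) category" and B :: "('bo, 'bm) category"
    and S :: "('ao, 'am, 'bo, 'bm) adjn" +
  assumes unit_natural: "natural_transformation B B fident (radj S \<circ>\<^sub>F ladj S) (unit S)"
    and counit_natural: "natural_transformation A A (ladj S \<circ>\<^sub>F radj S) fident (counit S)"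
    and triangle_left: "x \<in> Obj B \<Longrightarrow>
      counit S (omap (ladj S) x) \<cdot>\<^bsub>A\<^esub> amap (ladj S) (unit S x) = Ide A (omap (ladj S) x)"
    and triangle_right: "a \<in> Obj A \<Longrightarrow>
      amap (radj S) (counit S a) \<cdot>\<^bsub>B\<^esub> unit S (omap (radj S) a) = Ide B (omap (radj S) a)"


section \<open>Fibrations and images\<close>

definition cartesian_over ::
  "('o, 'm) category \<Rightarrow> ('p, 'n) category \<Rightarrow> ('o, 'm, 'p, 'n) functr \<Rightarrow> 'm \<Rightarrow> 'n \<Rightarrow> bool" where
  "cartesian_over C D F f f' \<longleftrightarrow>
    f \<in> Arr C \<and> f' \<in> Arr D \<and> amap F f = f' \<and>
    (\<forall>g \<in> Arr C. \<forall>h \<in> hom D (omap F (Dom C g)) (omap F (Dom C f)).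
       Cod C g = Cod C f \<longrightarrow> amap F f \<cdot>\<^bsub>D\<^esub> h = amap F g \<longrightarrow>
       (\<exists>!k. k \<in> hom C (Dom C g) (Dom C f) \<and> amap F k = h \<and> f \<cdot>\<^bsub>C\<^esub> k = g))"

definition fibration ::
  "('o, 'm) category \<Rightarrow> ('p, 'n) category \<Rightarrow> ('o, 'm, 'p, 'n) functr \<Rightarrow> 'n set \<Rightarrow> bool" where
  "fibration C D F M \<longleftrightarrow> is_functor C D F \<and>
    (\<forall>c \<in> Obj C. \<forall>f' \<in> M. f' \<in> Arr D \<and> Cod D f' = omap F c \<longrightarrow>
       (\<exists>f. Cod C f = c \<and> cartesian_over C D F f f'))"

definition isofibration ::
  "('o, 'm) category \<Rightarrow> ('p, 'n) category \<Rightarrow> ('o, 'm, 'p, 'n) functr \<Rightarrow> bool" where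
  "isofibration C D F \<longleftrightarrow> is_functor C D F \<and>
    (\<forall>c \<in> Obj C. \<forall>f'. isomorphism D f' \<and> Cod D f' = omap F c \<longrightarrow>
       (\<exists>f. isomorphism C f \<and> Cod C f = c \<and> amap F f = f'))"

definition discrete_isofibration ::
  "('o, 'm) category \<Rightarrow> ('p, 'n) category \<Rightarrow> ('o, 'm, 'p, 'n) functr \<Rightarrow> bool" where
  "discrete_isofibration C D F \<longleftrightarrow> isofibration C D F \<and>
    (\<forall>c \<in> Obj C. \<forall>f'. isomorphism D f' \<and> Cod D f' = omap F c \<longrightarrow>
       (\<exists>!f. isomorphism C f \<and> Cod C f = c \<and> amap F f = f'))"

definition full_subcategory :: "('o, 'm) category \<Rightarrow> 'o set \<Rightarrow> ('o, 'm) category" where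
  "full_subcategory D X =
    D\<lparr>Obj := X, Arr := {f \<in> Arr D. Dom D f \<in> X \<and> Cod D f \<in> X}\<rparr>"

text \<open>In general \<open>strict_image\<close> need not be closed under composition; it is only the collection
  of objects and morphisms in the image, with the operations of \<open>D\<close>.\<close>

definition strict_image ::
  "('o, 'm) category \<Rightarrow> ('p, 'n) category \<Rightarrow> ('o, 'm, 'p, 'n) functr \<Rightarrow> ('p, 'n) category" where
  "strict_image C D F = D\<lparr>Obj := omap F ` Obj C, Arr := amap F ` Arr C\<rparr>"

definition full_image ::
  "('o, 'm) category \<Rightarrow> ('p, 'n) category \<Rightarrow> ('o, 'm, 'p, 'n) functr \<Rightarrow> ('p, 'n) category" where
  "full_image C D F = full_subcategory D (omap F ` Obj C)"

definition ess_image ::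
  "('o, 'm) category \<Rightarrow> ('p, 'n) category \<Rightarrow> ('o, 'm, 'p, 'n) functr \<Rightarrow> ('p, 'n) category" where
  "ess_image C D F =
    full_subcategory D {d \<in> Obj D. \<exists>c \<in> Obj C. isomorphic D d (omap F c)}"


section \<open>Carrier types for the towers\<close>

text \<open>Both towers consist, at stage \<open>n + 1\<close>, of pairs (object of stage \<open>n\<close>, structure map) and of
  morphisms of stage \<open>n\<close> commuting with the structure maps. As the stage is a natural number, all
  stages must inhabit one type of objects and one type of morphisms. \<open>Str X b\<close> is the pair
  \<open>(X, b)\<close>; \<open>Mor X f Y\<close> is the morphism \<open>f\<close> regarded as a morphism from \<open>X\<close> to \<open>Y\<close> of the next
  stage; \<open>Base\<close> and \<open>BaseArr\<close> tag the objects and morphisms of the category \<open>B\<close>, so stage \<open>0\<close>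
  is \<open>B\<close> up to this tagging.\<close>

datatype ('o, 'm) tobj =
    Base (untag_obj: 'o)
  | Str (underlying: "('o, 'm) tobj") (strmap: "('o, 'm) tarr")
and ('o, 'm) tarr =
    BaseArr (untag_arr: 'm)
  | Mor (src: "('o, 'm) tobj") (under: "('o, 'm) tarr") (tgt: "('o, 'm) tobj")

type_synonym ('o, 'm) tcat = "(('o, 'm) tobj, ('o, 'm) tarr) category"

definition tagged_category :: "('o, 'm) category \<Rightarrow> ('o, 'm) tcat" where
  "tagged_category B = \<lparr>
    Obj = Base ` Obj B,
    Arr = BaseArr ` Arr B,
    Dom = (\<lambda>f. Base (Dom B (untag_arr f))),
    Cod = (\<lambda>f. Base (Cod B (untag_arr f))),
    Ide = (\<lambda>x. BaseArr (Ide B (untag_obj x))),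
    Comp = (\<lambda>g f. BaseArr (untag_arr g \<cdot>\<^bsub>B\<^esub> untag_arr f))\<rparr>"

definition tag :: "('o, 'm, ('o, 'm) tobj, ('o, 'm) tarr) functr" where
  "tag = \<lparr>omap = Base, amap = BaseArr\<rparr>"

definition untag :: "(('o, 'm) tobj, ('o, 'm) tarr, 'o, 'm) functr" where
  "untag = \<lparr>omap = untag_obj, amap = untag_arr\<rparr>"

definition tagged_adjn ::
  "('ao, 'am, 'o, 'm) adjn \<Rightarrow> ('ao, 'am, ('o, 'm) tobj, ('o, 'm) tarr) adjn" where
  "tagged_adjn S = \<lparr>
    ladj = ladj S \<circ>\<^sub>F untag,
    radj = tag \<circ>\<^sub>F radj S,
    unit = (\<lambda>x. BaseArr (unit S (untag_obj x))),
    counit = counit S\<rparr>"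

definition structured_category ::
  "('o, 'm) tcat \<Rightarrow> ('o, 'm) tobj set \<Rightarrow>
   (('o, 'm) tobj \<Rightarrow> ('o, 'm) tarr \<Rightarrow> ('o, 'm) tobj \<Rightarrow> bool) \<Rightarrow> ('o, 'm) tcat" where
  "structured_category C X comm = \<lparr>
    Obj = X,
    Arr = {Mor x f y | x f y.
             x \<in> X \<and> y \<in> X \<and> f \<in> hom C (underlying x) (underlying y) \<and> comm x f y},
    Dom = src,
    Cod = tgt,
    Ide = (\<lambda>x. Mor x (Ide C (underlying x)) x),
    Comp = (\<lambda>g f. Mor (src f) (under g \<cdot>\<^bsub>C\<^esub> under f) (tgt g))\<rparr>"

text \<open>The functor forgetting the last structure map (\<open>U\<close> from stage \<open>n + 1\<close> to stage \<open>n\<close>).\<close>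

definition forget :: "(('o, 'm) tobj, ('o, 'm) tarr, ('o, 'm) tobj, ('o, 'm) tarr) functr" where
  "forget = \<lparr>omap = underlying, amap = under\<rparr>"


section \<open>Passage to the next adjunction\<close>

text \<open>Common to both towers: \<open>S\<close> is the adjunction at stage \<open>n\<close> between \<open>A\<close> and \<open>C\<close>,
  \<open>r a\<close> is the structure map put on \<open>radj S\<close> applied to \<open>a\<close>, and \<open>q x\<close> is the chosen
  coequalizer from the stage \<open>n\<close> left adjoint on \<open>underlying x\<close> to the next left adjoint on \<open>x\<close>.
  The next left adjoint on a morphism \<open>f\<close> from \<open>x\<close> to \<open>y\<close>, and the next counit, are
  induced by the universal property of \<open>q\<close>.\<close>

definition next_radj ::
  "('ao, 'am) category \<Rightarrow> ('ao, 'am, ('o, 'm) tobj, ('o, 'm) tarr) adjn \<Rightarrow>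
   ('ao \<Rightarrow> ('o, 'm) tarr) \<Rightarrow> ('ao, 'am, ('o, 'm) tobj, ('o, 'm) tarr) functr" where
  "next_radj A S r =
    (let R' = (\<lambda>a. Str (omap (radj S) a) (r a))
     in \<lparr>omap = R', amap = (\<lambda>f. Mor (R' (Dom A f)) (amap (radj S) f) (R' (Cod A f)))\<rparr>)"

definition next_ladj ::
  "('ao, 'am) category \<Rightarrow> ('ao, 'am, ('o, 'm) tobj, ('o, 'm) tarr) adjn \<Rightarrow>
   (('o, 'm) tobj \<Rightarrow> 'am) \<Rightarrow> (('o, 'm) tobj, ('o, 'm) tarr, 'ao, 'am) functr" where
  "next_ladj A S q = \<lparr>
    omap = (\<lambda>x. Cod A (q x)),
    amap = (\<lambda>f. THE k. k \<in> hom A (Cod A (q (src f))) (Cod A (q (tgt f))) \<and>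
                  k \<cdot>\<^bsub>A\<^esub> q (src f) = q (tgt f) \<cdot>\<^bsub>A\<^esub> amap (ladj S) (under f))\<rparr>"

definition next_adjn ::
  "('ao, 'am) category \<Rightarrow> ('o, 'm) tcat \<Rightarrow> ('ao, 'am, ('o, 'm) tobj, ('o, 'm) tarr) adjn \<Rightarrow>
   ('ao \<Rightarrow> ('o, 'm) tarr) \<Rightarrow> (('o, 'm) tobj \<Rightarrow> 'am) \<Rightarrow>
   ('ao, 'am, ('o, 'm) tobj, ('o, 'm) tarr) adjn" where
  "next_adjn A C S r q =
    (let R' = next_radj A S r; L' = next_ladj A S q
     in \<lparr>ladj = L',
         radj = R',
         unit = (\<lambda>x. Mor x (amap (radj S) (q x) \<cdot>\<^bsub>C\<^esub> unit S (underlying x)) (omap R' (omap L' x))),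
         counit = (\<lambda>a. THE k. k \<in> hom A (omap L' (omap R' a)) a \<and>
                         k \<cdot>\<^bsub>A\<^esub> q (omap R' a) = counit S a)\<rparr>)"


section \<open>Adjoint decomposition\<close>

text \<open>\<open>to_base\<close> is the composite forgetful functor to \<open>B\<close>; in the adjoint decomposition,
  \<open>quot\<close> is the transformation \<open>\<pi>\<close> from \<open>L U\<close> to the stage \<open>n\<close> left adjoint.\<close>

record ('ao, 'am, 'o, 'm) stage =
  cat :: "('o, 'm) tcat"
  to_base :: "(('o, 'm) tobj, ('o, 'm) tarr, 'o, 'm) functr"
  adj :: "('ao, 'am, ('o, 'm) tobj, ('o, 'm) tarr) adjn"

record ('ao, 'am, 'o, 'm) decomp_stage = "('ao, 'am, 'o, 'm) stage" +
  quot :: "('o, 'm) tobj \<Rightarrow> 'am"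

definition decomp_category ::
  "('o, 'm) category \<Rightarrow> ('ao, 'am, 'o, 'm) adjn \<Rightarrow> ('ao, 'am, 'o, 'm) decomp_stage \<Rightarrow>
   ('o, 'm) tcat" where
  "decomp_category B S D = structured_category (cat D)
     {Str x (BaseArr b) | x b. x \<in> Obj (cat D) \<and>
        b \<in> hom B (omap (radj S) (omap (ladj (adj D)) x)) (omap (to_base D) x)}
     (\<lambda>x f y. amap (to_base D) f \<cdot>\<^bsub>B\<^esub> untag_arr (strmap x) =
              untag_arr (strmap y) \<cdot>\<^bsub>B\<^esub> amap (radj S) (amap (ladj (adj D)) f))"

definition decomp_coeq ::
  "('ao, 'am) category \<Rightarrow> ('am \<Rightarrow> 'am \<Rightarrow> 'am) \<Rightarrow> ('ao, 'am, 'o, 'm) adjn \<Rightarrow>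
   ('ao, 'am, 'o, 'm) decomp_stage \<Rightarrow> ('o, 'm) tobj \<Rightarrow> 'am" where
  "decomp_coeq A coeq S D x =
     coeq (quot D (underlying x) \<cdot>\<^bsub>A\<^esub> amap (ladj S) (untag_arr (strmap x)))
          (counit S (omap (ladj (adj D)) (underlying x)))"

definition next_decomp_stage ::
  "('ao, 'am) category \<Rightarrow> ('am \<Rightarrow> 'am \<Rightarrow> 'am) \<Rightarrow> ('o, 'm) category \<Rightarrow>
   ('ao, 'am, 'o, 'm) adjn \<Rightarrow> ('ao, 'am, 'o, 'm) decomp_stage \<Rightarrow>
   ('ao, 'am, 'o, 'm) decomp_stage" where
  "next_decomp_stage A coeq B S D =
    (let p = decomp_coeq A coeq S D
     in \<lparr>cat = decomp_category B S D,
         to_base = to_base D \<circ>\<^sub>F forget,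
         adj = next_adjn A (cat D) (adj D) (\<lambda>a. BaseArr (amap (radj S) (counit (adj D) a))) p,
         quot = (\<lambda>x. p x \<cdot>\<^bsub>A\<^esub> quot D (underlying x))\<rparr>)"

primrec decomp ::
  "('ao, 'am) category \<Rightarrow> ('am \<Rightarrow> 'am \<Rightarrow> 'am) \<Rightarrow> ('o, 'm) category \<Rightarrow>
   ('ao, 'am, 'o, 'm) adjn \<Rightarrow> nat \<Rightarrow> ('ao, 'am, 'o, 'm) decomp_stage" where
  "decomp A coeq B S 0 = \<lparr>
     cat = tagged_category B,
     to_base = untag,
     adj = tagged_adjn S,
     quot = (\<lambda>x. Ide A (omap (ladj S) (untag_obj x)))\<rparr>"
| "decomp A coeq B S (Suc n) = next_decomp_stage A coeq B S (decomp A coeq B S n)"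


section \<open>Monadic tower\<close>

record ('o, 'm) monad =
  mfun :: "('o, 'm, 'o, 'm) functr"
  mmult :: "'o \<Rightarrow> 'm"
  munit :: "'o \<Rightarrow> 'm"

definition induced_monad :: "('ao, 'am, 'bo, 'bm) adjn \<Rightarrow> ('bo, 'bm) monad" where
  "induced_monad S = \<lparr>
     mfun = radj S \<circ>\<^sub>F ladj S,
     mmult = (\<lambda>x. amap (radj S) (counit S (omap (ladj S) x))),
     munit = unit S\<rparr>"

definition eilenberg_moore ::
  "('o, 'm) tcat \<Rightarrow> (('o, 'm) tobj, ('o, 'm) tarr) monad \<Rightarrow> ('o, 'm) tcat" where
  "eilenberg_moore C T = structured_category C
     {Str v \<mu> | v \<mu>. v \<in> Obj C \<and> \<mu> \<in> hom C (omap (mfun T) v) v \<and>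
        \<mu> \<cdot>\<^bsub>C\<^esub> munit T v = Ide C v \<and>
        \<mu> \<cdot>\<^bsub>C\<^esub> amap (mfun T) \<mu> = \<mu> \<cdot>\<^bsub>C\<^esub> mmult T v}
     (\<lambda>x f y. f \<cdot>\<^bsub>C\<^esub> strmap x = strmap y \<cdot>\<^bsub>C\<^esub> amap (mfun T) f)"

definition monadic_coeq ::
  "('am \<Rightarrow> 'am \<Rightarrow> 'am) \<Rightarrow> ('ao, 'am, ('o, 'm) tobj, ('o, 'm) tarr) adjn \<Rightarrow>
   ('o, 'm) tobj \<Rightarrow> 'am" where
  "monadic_coeq coeq S x =
     coeq (amap (ladj S) (strmap x)) (counit S (omap (ladj S) (underlying x)))"

definition next_monadic_stage ::
  "('ao, 'am) category \<Rightarrow> ('am \<Rightarrow> 'am \<Rightarrow> 'am) \<Rightarrow>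
   ('ao, 'am, 'o, 'm) stage \<Rightarrow> ('ao, 'am, 'o, 'm) stage" where
  "next_monadic_stage A coeq M = \<lparr>
     cat = eilenberg_moore (cat M) (induced_monad (adj M)),
     to_base = to_base M \<circ>\<^sub>F forget,
     adj = next_adjn A (cat M) (adj M) (\<lambda>a. amap (radj (adj M)) (counit (adj M) a))
             (monadic_coeq coeq (adj M))\<rparr>"

primrec monadic_tower ::
  "('ao, 'am) category \<Rightarrow> ('am \<Rightarrow> 'am \<Rightarrow> 'am) \<Rightarrow> ('o, 'm) category \<Rightarrow>
   ('ao, 'am, 'o, 'm) adjn \<Rightarrow> nat \<Rightarrow> ('ao, 'am, 'o, 'm) stage" where
  "monadic_tower A coeq B S 0 =
     \<lparr>cat = tagged_category B, to_base = untag, adj = tagged_adjn S\<rparr>"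
| "monadic_tower A coeq B S (Suc n) = next_monadic_stage A coeq (monadic_tower A coeq B S n)"


section \<open>The comparison between the towers\<close>

definition lam ::
  "('ao, 'am) category \<Rightarrow> ('ao, 'am, 'o, 'm) stage \<Rightarrow> ('ao, 'am, 'o, 'm) decomp_stage \<Rightarrow>
   (('o, 'm) tobj, ('o, 'm) tarr, ('o, 'm) tobj, ('o, 'm) tarr) functr \<Rightarrow>
   ('o, 'm) tobj \<Rightarrow> 'am" where
  "lam A M D \<Lambda> v =
     counit (adj D) (omap (ladj (adj M)) v) \<cdot>\<^bsub>A\<^esub>
     amap (ladj (adj D)) (amap \<Lambda> (unit (adj M) v))"

definition next_Lam ::
  "('ao, 'am) category \<Rightarrow> ('o, 'm) category \<Rightarrow> ('ao, 'am, 'o, 'm) adjn \<Rightarrow>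
   ('ao, 'am, 'o, 'm) stage \<Rightarrow> ('ao, 'am, 'o, 'm) decomp_stage \<Rightarrow>
   (('o, 'm) tobj, ('o, 'm) tarr, ('o, 'm) tobj, ('o, 'm) tarr) functr \<Rightarrow>
   (('o, 'm) tobj, ('o, 'm) tarr, ('o, 'm) tobj, ('o, 'm) tarr) functr" where
  "next_Lam A B S M D \<Lambda> =
    (let \<Lambda>' = (\<lambda>x. Str (omap \<Lambda> (underlying x))
                  (BaseArr (amap (to_base M) (strmap x) \<cdot>\<^bsub>B\<^esub>
                            amap (radj S) (lam A M D \<Lambda> (underlying x)))))
     in \<lparr>omap = \<Lambda>', amap = (\<lambda>f. Mor (\<Lambda>' (src f)) (amap \<Lambda> (under f)) (\<Lambda>' (tgt f)))\<rparr>)"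

primrec Lam ::
  "('ao, 'am) category \<Rightarrow> ('am \<Rightarrow> 'am \<Rightarrow> 'am) \<Rightarrow> ('o, 'm) category \<Rightarrow>
   ('ao, 'am, 'o, 'm) adjn \<Rightarrow> nat \<Rightarrow>
   (('o, 'm) tobj, ('o, 'm) tarr, ('o, 'm) tobj, ('o, 'm) tarr) functr" where
  "Lam A coeq B S 0 = fident"
| "Lam A coeq B S (Suc n) =
     next_Lam A B S (monadic_tower A coeq B S n) (decomp A coeq B S n) (Lam A coeq B S n)"

definition mono_class ::
  "('o, 'm) category \<Rightarrow> ('p, 'n) category \<Rightarrow> ('o, 'm, 'p, 'n) functr \<Rightarrow> 'm set" where
  "mono_class C D U = {f \<in> Arr C. monomorphism D (amap U f)}"

end

theory Submission
  imports Defs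
begin

text \<open>Write \<open>U\<close> for the forgetful functors to \<open>B\<close>, and \<open>v\<close>, \<open>\<mu>\<close>, \<open>b\<close>, \<open>\<Lambda>\<close>, \<open>\<lambda>\<close>, \<open>R\<close>, \<open>L\<close>
  for the data of a fixed stage. The functor \<open>\<Lambda>\<close> is fully faithful and injective on objects. Along
  a fully faithful functor every arrow is cartesian, so the fibration property only concerns
  objects: if \<open>f : d \<rightarrow> \<Lambda> w\<close> is such that \<open>U f\<close> is a monomorphism, then \<open>d\<close> has to be the image
  of an object (\<open>mono_closed\<close>). Isomorphisms are among these \<open>f\<close>; this gives the isofibration
  property and closes the image under isomorphism, injectivity on objects makes the lifts unique,
  and fullness identifies the arrows of the image.

  The closure property is proved by induction on the stage. Let \<open>f : (d, b) \<rightarrow> \<Lambda> (w, \<mu>)\<close> be an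
  arrow of the next stage with \<open>U f\<close> a monomorphism. By induction \<open>d = \<Lambda> v\<close> and \<open>f = \<Lambda> g\<close> for some
  \<open>g : v \<rightarrow> w\<close>. The structure map \<open>b\<close>, transported along the isomorphism \<open>\<lambda> v\<close>, is an arrow of \<open>B\<close>
  whose composite with \<open>U g\<close> underlies the arrow \<open>\<mu> \<cdot> R L g\<close> of the monadic tower. Now a second
  property is needed, carried along in the same induction: arrows of the monadic tower with
  monic image in \<open>B\<close> are cartesian over \<open>B\<close> (\<open>mono_lift\<close>). It turns \<open>b\<close> into an arrow
  \<open>\<nu> : R L v \<rightarrow> v\<close> with \<open>g \<cdot> \<nu> = \<mu> \<cdot> R L g\<close>, and the two algebra laws for \<open>\<nu>\<close> follow from those for
  \<open>\<mu>\<close> by cancelling the monomorphism \<open>g\<close>. Thus \<open>(v, \<nu>)\<close> is an algebra that \<open>\<Lambda>\<close> sends to \<open>(d, b)\<close>.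

  The remaining work is to know that every stage is an adjunction and that \<open>\<lambda>\<close> is invertible. The
  step of either tower is an instance of one construction (\<open>structured_step\<close>): the Eilenberg-Moore
  category is the case in which the base adjunction is the current stage itself and only the
  algebras are retained as objects. Invertibility of \<open>\<lambda>\<close> holds because \<open>\<Lambda>\<close> is fully faithful and
  carries the right adjoint of one tower to that of the other: it then maps the unit at \<open>v\<close> to a
  universal arrow from \<open>\<Lambda> v\<close>, and \<open>\<lambda> v\<close> is the induced map between two universal arrows.\<close>

section \<open>Categories, functors and adjunctions\<close>

text \<open>The laws of categories, functors and adjunctions are restated with side conditions of the
  form \<open>Dom g = Cod f\<close>. Unlike membership in \<open>hom\<close>, these mention no objects beyond
  those determined by the arrows, so that conditional rewriting can discharge them.\<close>

lemma in_hom_iff [simp]: "f \<in> hom C x y \<longleftrightarrow> f \<in> Arr C \<and> Dom C f = x \<and> Cod C f = y"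
  by (simp add: hom_def)

context category
begin

lemma arr_comp [simp]:
  assumes "f \<in> Arr C" "g \<in> Arr C" "Dom C g = Cod C f"
  shows "g \<cdot> f \<in> Arr C" "Dom C (g \<cdot> f) = Dom C f" "Cod C (g \<cdot> f) = Cod C g"
  using comp_hom[of f "Dom C f" "Cod C f" g "Cod C g"] assms by auto

lemma arr_ide [simp]:
  assumes "x \<in> Obj C"
  shows "Ide C x \<in> Arr C" "Dom C (Ide C x) = x" "Cod C (Ide C x) = x"
  using ide_hom[OF assms] by auto

lemma obj_dom_cod [simp]:
  assumes "f \<in> Arr C" shows "Dom C f \<in> Obj C" "Cod C f \<in> Obj C"
  using assms dom_obj cod_obj by auto

lemma comp_ide_right [simp]: "f \<in> Arr C \<Longrightarrow> Dom C f = x \<Longrightarrow> f \<cdot> Ide C x = f"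
  using comp_ide[of f x "Cod C f"] by auto

lemma comp_ide_left [simp]: "f \<in> Arr C \<Longrightarrow> Cod C f = x \<Longrightarrow> Ide C x \<cdot> f = f"
  using ide_comp[of f "Dom C f" x] by auto

lemma comp_assoc_arr [simp]:
  assumes "f \<in> Arr C" "g \<in> Arr C" "h \<in> Arr C" "Dom C g = Cod C f" "Dom C h = Cod C g"
  shows "(h \<cdot> g) \<cdot> f = h \<cdot> (g \<cdot> f)"
  using comp_assoc[of f "Dom C f" "Cod C f" g "Cod C g" h "Cod C h"] assms by auto

lemma monomorphism_cancel:
  assumes "monomorphism C f" "g \<in> Arr C" "h \<in> Arr C" "Cod C g = Dom C f" "Cod C h = Dom C f"
    "Dom C g = Dom C h" "f \<cdot> g = f \<cdot> h"
  shows "g = h"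
  using assms by (auto simp: monomorphism_def)

lemma isomorphism_monomorphism:
  assumes "isomorphism C f" shows "monomorphism C f"
  unfolding monomorphism_def
proof (intro conjI allI ballI impI)
  show "f \<in> Arr C" using assms by (simp add: isomorphism_def)
next
  fix x g h
  assume gh: "g \<in> hom C x (Dom C f)" "h \<in> hom C x (Dom C f)" and eq: "f \<cdot> g = f \<cdot> h"
  obtain k where k: "k \<in> hom C (Cod C f) (Dom C f)" "k \<cdot> f = Ide C (Dom C f)"
    using assms by (auto simp: isomorphism_def)
  have f: "f \<in> Arr C" using assms by (simp add: isomorphism_def)
  have "g = (k \<cdot> f) \<cdot> g" using gh by (subst k(2)) simp
  also have "\<dots> = k \<cdot> (f \<cdot> h)" using gh k(1) f by (simp add: eq)
  also have "\<dots> = (k \<cdot> f) \<cdot> h" using gh k(1) f by simp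
  also have "\<dots> = h" using gh by (subst k(2)) simp
  finally show "g = h" .
qed

lemma isomorphism_cancel_right:
  assumes "isomorphism C f" "g \<in> Arr C" "h \<in> Arr C" "Dom C g = Cod C f" "Dom C h = Cod C f"
    "g \<cdot> f = h \<cdot> f"
  shows "g = h"
proof -
  obtain k where k: "k \<in> hom C (Cod C f) (Dom C f)" "f \<cdot> k = Ide C (Cod C f)"
    using assms(1) by (auto simp: isomorphism_def)
  have f: "f \<in> Arr C" using assms by (simp add: isomorphism_def)
  have "g = g \<cdot> (f \<cdot> k)" using assms by (subst k(2)) simp
  also have "\<dots> = h \<cdot> (f \<cdot> k)"
    using comp_assoc_arr[of k f g] comp_assoc_arr[of k f h] assms k(1) f by auto
  also have "\<dots> = h" using assms by (subst k(2)) simp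
  finally show ?thesis .
qed

text \<open>Composites are normalised to the right, so an equation between two composites has to be
  applied to a prefix of a longer composite.\<close>

lemma comp_eq_extend:
  assumes "g \<cdot> f = h \<cdot> k" "f \<in> Arr C" "g \<in> Arr C" "h \<in> Arr C" "k \<in> Arr C" "w \<in> Arr C"
    "Dom C g = Cod C f" "Dom C h = Cod C k" "Dom C f = Cod C w" "Dom C k = Cod C w"
  shows "g \<cdot> (f \<cdot> w) = h \<cdot> (k \<cdot> w)"
  using comp_assoc_arr[of w f g] comp_assoc_arr[of w k h] assms by auto

lemma coequalizer_epi:
  assumes q: "coequalizer C u v q"
    and "g \<in> Arr C" "h \<in> Arr C" "Dom C g = Cod C q" "Dom C h = Cod C q" "g \<cdot> q = h \<cdot> q"
  shows "g = h"
proof -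
  have arr: "u \<in> Arr C" "v \<in> Arr C" "q \<in> Arr C" "Dom C v = Dom C u" "Cod C v = Cod C u"
    "Dom C q = Cod C u" and eq: "q \<cdot> u = q \<cdot> v"
    using q by (auto simp: coequalizer_def)
  have "(g \<cdot> q) \<cdot> u = (g \<cdot> q) \<cdot> v" using arr eq assms(2,4) by simp
  moreover have "g \<cdot> q \<in> hom C (Cod C u) (Cod C g)" using arr assms(2,4) by simp
  ultimately have "\<exists>!k. k \<in> hom C (Cod C q) (Cod C g) \<and> k \<cdot> q = g \<cdot> q"
    using q unfolding coequalizer_def by blast
  moreover have "Cod C g = Cod C h"
    using arr_comp(3)[of q g] arr_comp(3)[of q h] arr assms(2-6) by simp
  ultimately show ?thesis using assms by auto
qed

lemma coequalizer_factor:
  assumes "coequalizer C u v q" "h \<in> Arr C" "Dom C h = Cod C u" "h \<cdot> u = h \<cdot> v"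
  shows "\<exists>!k. k \<in> hom C (Cod C q) (Cod C h) \<and> k \<cdot> q = h"
  using assms by (auto simp: coequalizer_def)

end

context is_functor
begin

lemma omap_in_obj [simp]: "x \<in> Obj C \<Longrightarrow> omap F x \<in> Obj D"
  by (rule omap_obj)

lemma amap_arr [simp]:
  assumes "f \<in> Arr C"
  shows "amap F f \<in> Arr D" "Dom D (amap F f) = omap F (Dom C f)"
    "Cod D (amap F f) = omap F (Cod C f)"
  using amap_hom[of f "Dom C f" "Cod C f"] assms by auto

lemma amap_ide_eq [simp]: "x \<in> Obj C \<Longrightarrow> amap F (Ide C x) = Ide D (omap F x)"
  by (rule amap_ide)

lemma amap_comp_eq [simp]:
  assumes "f \<in> Arr C" "g \<in> Arr C" "Dom C g = Cod C f"
  shows "amap F (g \<cdot>\<^bsub>C\<^esub> f) = amap F g \<cdot>\<^bsub>D\<^esub> amap F f"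
  using amap_comp[of f "Dom C f" "Cod C f" g "Cod C g"] assms by auto

lemma isomorphism_amap:
  assumes "isomorphism C f" shows "isomorphism D (amap F f)"
proof -
  obtain g where f: "f \<in> Arr C" and g: "g \<in> hom C (Cod C f) (Dom C f)"
    "g \<cdot>\<^bsub>C\<^esub> f = Ide C (Dom C f)" "f \<cdot>\<^bsub>C\<^esub> g = Ide C (Cod C f)"
    using assms by (auto simp: isomorphism_def)
  have "amap F g \<cdot>\<^bsub>D\<^esub> amap F f = Ide D (omap F (Dom C f))"
    "amap F f \<cdot>\<^bsub>D\<^esub> amap F g = Ide D (omap F (Cod C f))"
    using f g amap_comp_eq[of f g] amap_comp_eq[of g f] by auto
  then show ?thesis
    unfolding isomorphism_def using f g(1) by (auto intro!: bexI[of _ "amap F g"])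
qed

end

lemma fcomp_simps [simp]:
  "omap (G \<circ>\<^sub>F F) x = omap G (omap F x)" "amap (G \<circ>\<^sub>F F) f = amap G (amap F f)"
  by (simp_all add: fcomp_def)

lemma fident_simps [simp]: "omap fident x = x" "amap fident f = f"
  by (simp_all add: fident_def)

lemma is_functor_fcomp:
  assumes "is_functor C D F" "is_functor D E G" shows "is_functor C E (G \<circ>\<^sub>F F)"
proof -
  interpret F: is_functor C D F by fact
  interpret G: is_functor D E G by fact
  show ?thesis by unfold_locales auto
qed

lemma is_functor_fident:
  assumes "category C" shows "is_functor C C fident"
proof -
  interpret category C by fact
  show ?thesis by unfold_locales auto
qed

lemma natural_transformation_iff:
  "natural_transformation C D F G \<alpha> \<longleftrightarrow>
    (\<forall>x \<in> Obj C. \<alpha> x \<in> hom D (omap F x) (omap G x)) \<and>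
    (\<forall>f \<in> Arr C. \<alpha> (Cod C f) \<cdot>\<^bsub>D\<^esub> amap F f = amap G f \<cdot>\<^bsub>D\<^esub> \<alpha> (Dom C f))"
  by (auto simp: natural_transformation_def)

context adjunction
begin

lemma unit_arr [simp]:
  assumes "x \<in> Obj B"
  shows "unit S x \<in> Arr B" "Dom B (unit S x) = x"
    "Cod B (unit S x) = omap (radj S) (omap (ladj S) x)"
  using assms unit_natural by (auto simp: natural_transformation_iff)

lemma counit_arr [simp]:
  assumes "a \<in> Obj A"
  shows "counit S a \<in> Arr A" "Cod A (counit S a) = a"
    "Dom A (counit S a) = omap (ladj S) (omap (radj S) a)"
  using assms counit_natural by (auto simp: natural_transformation_iff)

lemma unit_naturality:
  assumes "f \<in> Arr B"
  shows "unit S (Cod B f) \<cdot>\<^bsub>B\<^esub> f = amap (radj S) (amap (ladj S) f) \<cdot>\<^bsub>B\<^esub> unit S (Dom B f)"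
  using assms unit_natural by (auto simp: natural_transformation_iff)

lemma counit_naturality:
  assumes "f \<in> Arr A"
  shows "counit S (Cod A f) \<cdot>\<^bsub>A\<^esub> amap (ladj S) (amap (radj S) f) = f \<cdot>\<^bsub>A\<^esub> counit S (Dom A f)"
  using assms counit_natural by (auto simp: natural_transformation_iff)

lemma transpose_of_adjunct:
  assumes f: "f \<in> Arr B" "Cod B f = omap (radj S) a" and a: "a \<in> Obj A"
  shows "amap (radj S) (counit S a \<cdot>\<^bsub>A\<^esub> amap (ladj S) f) \<cdot>\<^bsub>B\<^esub> unit S (Dom B f) = f"
proof -
  have "amap (radj S) (counit S a \<cdot>\<^bsub>A\<^esub> amap (ladj S) f) \<cdot>\<^bsub>B\<^esub> unit S (Dom B f)
      = amap (radj S) (counit S a) \<cdot>\<^bsub>B\<^esub> (amap (radj S) (amap (ladj S) f) \<cdot>\<^bsub>B\<^esub> unit S (Dom B f))"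
    using assms by simp
  also have "\<dots> = amap (radj S) (counit S a) \<cdot>\<^bsub>B\<^esub> (unit S (omap (radj S) a) \<cdot>\<^bsub>B\<^esub> f)"
    using unit_naturality[OF f(1)] f(2) by simp
  also have "\<dots> = (amap (radj S) (counit S a) \<cdot>\<^bsub>B\<^esub> unit S (omap (radj S) a)) \<cdot>\<^bsub>B\<^esub> f"
    using assms by simp
  also have "\<dots> = f" using assms by (subst triangle_right) auto
  finally show ?thesis .
qed

lemma adjunct_of_transpose:
  assumes g: "g \<in> Arr A" "Dom A g = omap (ladj S) x" and x: "x \<in> Obj B"
  shows "counit S (Cod A g) \<cdot>\<^bsub>A\<^esub> amap (ladj S) (amap (radj S) g \<cdot>\<^bsub>B\<^esub> unit S x) = g"
proof -
  have "counit S (Cod A g) \<cdot>\<^bsub>A\<^esub> amap (ladj S) (amap (radj S) g \<cdot>\<^bsub>B\<^esub> unit S x)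
      = (counit S (Cod A g) \<cdot>\<^bsub>A\<^esub> amap (ladj S) (amap (radj S) g)) \<cdot>\<^bsub>A\<^esub> amap (ladj S) (unit S x)"
    using assms by simp
  also have "\<dots> = g \<cdot>\<^bsub>A\<^esub> (counit S (omap (ladj S) x) \<cdot>\<^bsub>A\<^esub> amap (ladj S) (unit S x))"
    using assms by (simp add: counit_naturality)
  also have "\<dots> = g" using assms by (subst triangle_left) auto
  finally show ?thesis .
qed

lemma transpose_inject:
  assumes "g \<in> Arr A" "h \<in> Arr A" "Dom A g = omap (ladj S) x" "Dom A h = omap (ladj S) x"
    "Cod A g = Cod A h" "x \<in> Obj B"
    "amap (radj S) g \<cdot>\<^bsub>B\<^esub> unit S x = amap (radj S) h \<cdot>\<^bsub>B\<^esub> unit S x"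
  shows "g = h"
  using assms adjunct_of_transpose[of g x] adjunct_of_transpose[of h x] by metis

end


section \<open>Structure maps over an adjunction\<close>

text \<open>The invariant of the adjoint decomposition: a stage \<open>(C, T)\<close> over the adjunction \<open>S\<close> between
  \<open>A\<close> and \<open>E\<close>, with forgetful functor \<open>U\<close> and with \<open>p\<close> in the role of \<open>\<pi>\<close>. The two last conditions
  say that \<open>p\<close> is the mate of the identity \<open>U R\<^sub>T = R\<^sub>S\<close>.\<close>

locale stage_over =
  base: adjunction A E S + stage: adjunction A C T + U: is_functor C E U
  for A :: "('ao, 'am) category" and E :: "('eo, 'em) category" and S
    and C :: "('o, 'm) tcat" and T and U +
  fixes p :: "('o, 'm) tobj \<Rightarrow> 'am"
  assumes radj_obj [simp]: "a \<in> Obj A \<Longrightarrow> omap U (omap (radj T) a) = omap (radj S) a"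
    and radj_arr [simp]: "f \<in> Arr A \<Longrightarrow> amap U (amap (radj T) f) = amap (radj S) f"
    and quot_natural: "natural_transformation C A (ladj S \<circ>\<^sub>F U) (ladj T) p"
    and unit_quot: "x \<in> Obj C \<Longrightarrow>
      amap U (unit T x) = amap (radj S) (p x) \<cdot>\<^bsub>E\<^esub> unit S (omap U x)"
    and counit_quot: "a \<in> Obj A \<Longrightarrow> counit T a \<cdot>\<^bsub>A\<^esub> p (omap (radj T) a) = counit S a"
begin

lemma quot_arr [simp]:
  assumes "x \<in> Obj C"
  shows "p x \<in> Arr A" "Dom A (p x) = omap (ladj S) (omap U x)" "Cod A (p x) = omap (ladj T) x"
  using assms quot_natural by (auto simp: natural_transformation_iff)

lemma quot_naturality:
  assumes "f \<in> Arr C"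
  shows "p (Cod C f) \<cdot>\<^bsub>A\<^esub> amap (ladj S) (amap U f) = amap (ladj T) f \<cdot>\<^bsub>A\<^esub> p (Dom C f)"
  using assms quot_natural by (auto simp: natural_transformation_iff)

end

text \<open>Seen over itself, an adjunction satisfies the invariant trivially; this is how the monadic
  tower fits into the construction below.\<close>

lemma stage_over_self:
  fixes C :: "('o, 'm) tcat"
  assumes "adjunction A C T"
  shows "stage_over A C T C T fident (\<lambda>x. Ide A (omap (ladj T) x))"
proof -
  interpret T: adjunction A C T by fact
  interpret I: is_functor C C fident by (rule is_functor_fident) (rule T.left.dom.category_axioms)
  show ?thesis by unfold_locales (auto simp: natural_transformation_iff)
qed

lemma structured_category_simps [simp]:
  "Obj (structured_category C X comm) = X"
  "Dom (structured_category C X comm) = src"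
  "Cod (structured_category C X comm) = tgt"
  "Ide (structured_category C X comm) x = Mor x (Ide C (underlying x)) x"
  "g \<cdot>\<^bsub>structured_category C X comm\<^esub> f = Mor (src f) (under g \<cdot>\<^bsub>C\<^esub> under f) (tgt g)"
  by (simp_all add: structured_category_def)

lemma structured_category_arr_iff [simp]:
  "f \<in> Arr (structured_category C X comm) \<longleftrightarrow>
    (\<exists>x u y. f = Mor x u y) \<and> src f \<in> X \<and> tgt f \<in> X \<and>
    under f \<in> hom C (underlying (src f)) (underlying (tgt f)) \<and> comm (src f) (under f) (tgt f)"
  unfolding structured_category_def by (cases f) auto

lemma forget_simps [simp]: "omap forget x = underlying x" "amap forget f = under f"
  by (simp_all add: forget_def)

text \<open>One step of either tower. An object \<open>x\<close> carries a structure map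
  \<open>R\<^sub>S L\<^sub>T (underlying x) \<rightarrow> U (underlying x)\<close> in \<open>E\<close>, recovered from its encoding in \<open>strmap x\<close> by \<open>dec\<close>.
  Leaving the set \<open>X\<close> of objects open covers both the adjoint decomposition, which admits all
  structure maps, and the Eilenberg-Moore category, which admits only the algebras: the next
  adjunction is the same, provided that \<open>X\<close> contains the values of the next right adjoint.

  The equation \<open>dec_radj\<close> is kept out of the simplifier because it becomes an instance of
  reflexivity, and hence a looping rule, when \<open>dec\<close> is the identity.\<close>

locale structured_step = stage_over A E S C T U p
  for A :: "('ao, 'am) category" and E :: "('eo, 'em) category" and S
    and C :: "('o, 'm) tcat" and T and U and p +
  fixes dec :: "('o, 'm) tarr \<Rightarrow> 'em" and X :: "('o, 'm) tobj set"
    and r :: "'ao \<Rightarrow> ('o, 'm) tarr" and q :: "('o, 'm) tobj \<Rightarrow> 'am"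
  assumes underlying_obj [simp]: "x \<in> X \<Longrightarrow> underlying x \<in> Obj C"
    and dec_hom: "x \<in> X \<Longrightarrow> dec (strmap x) \<in>
      hom E (omap (radj S) (omap (ladj T) (underlying x))) (omap U (underlying x))"
    and radj_in [simp]: "a \<in> Obj A \<Longrightarrow> Str (omap (radj T) a) (r a) \<in> X"
    and dec_radj: "a \<in> Obj A \<Longrightarrow> dec (r a) = amap (radj S) (counit T a)"
    and q_coequalizer: "x \<in> X \<Longrightarrow> coequalizer A
      (p (underlying x) \<cdot>\<^bsub>A\<^esub> amap (ladj S) (dec (strmap x)))
      (counit S (omap (ladj T) (underlying x))) (q x)"
begin

abbreviation comm where
  "comm x f y \<equiv> amap U f \<cdot>\<^bsub>E\<^esub> dec (strmap x) =
    dec (strmap y) \<cdot>\<^bsub>E\<^esub> amap (radj S) (amap (ladj T) f)"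

abbreviation C' where "C' \<equiv> structured_category C X comm"
abbreviation T' where "T' \<equiv> next_adjn A C T r q"

lemma dec_arr [simp]:
  assumes "x \<in> X"
  shows "dec (strmap x) \<in> Arr E"
    "Dom E (dec (strmap x)) = omap (radj S) (omap (ladj T) (underlying x))"
    "Cod E (dec (strmap x)) = omap U (underlying x)"
  using dec_hom[OF assms] by auto

lemma category_structured: "category C'"
proof
  fix x y z f g
  assume f: "f \<in> hom C' x y" and g: "g \<in> hom C' y z"
  have "amap U (under g \<cdot>\<^bsub>C\<^esub> under f) \<cdot>\<^bsub>E\<^esub> dec (strmap x)
      = amap U (under g) \<cdot>\<^bsub>E\<^esub> (amap U (under f) \<cdot>\<^bsub>E\<^esub> dec (strmap x))"
    using f g by auto
  also have "\<dots> = amap U (under g) \<cdot>\<^bsub>E\<^esub> (dec (strmap y) \<cdot>\<^bsub>E\<^esub> amap (radj S) (amap (ladj T) (under f)))"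
    using f by auto
  also have "\<dots> = dec (strmap z) \<cdot>\<^bsub>E\<^esub> (amap (radj S) (amap (ladj T) (under g)) \<cdot>\<^bsub>E\<^esub>
      amap (radj S) (amap (ladj T) (under f)))"
    using f g by (intro base.left.dom.comp_eq_extend) auto
  finally show "g \<cdot>\<^bsub>C'\<^esub> f \<in> hom C' x z" using f g by auto
qed auto

sublocale C': category C' by (rule category_structured)

sublocale forget: is_functor C' C forget by unfold_locales auto

lemma q_arr [simp]:
  assumes "x \<in> X" shows "q x \<in> Arr A" "Dom A (q x) = omap (ladj T) (underlying x)"
  using q_coequalizer[OF assms] assms by (auto simp: coequalizer_def)

lemma q_coequalizes:
  assumes "x \<in> X"
  shows "q x \<cdot>\<^bsub>A\<^esub> (p (underlying x) \<cdot>\<^bsub>A\<^esub> amap (ladj S) (dec (strmap x))) =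
    q x \<cdot>\<^bsub>A\<^esub> counit S (omap (ladj T) (underlying x))"
  using q_coequalizer[OF assms] by (auto simp: coequalizer_def)

lemma q_cancel:
  assumes "x \<in> X" "g \<in> Arr A" "h \<in> Arr A" "Dom A g = Cod A (q x)" "Dom A h = Cod A (q x)"
    "g \<cdot>\<^bsub>A\<^esub> q x = h \<cdot>\<^bsub>A\<^esub> q x"
  shows "g = h"
  using base.left.cod.coequalizer_epi[OF q_coequalizer] assms by blast

lemma q_factor:
  assumes "x \<in> X" "h \<in> Arr A" "Dom A h = omap (ladj T) (underlying x)"
    "h \<cdot>\<^bsub>A\<^esub> (p (underlying x) \<cdot>\<^bsub>A\<^esub> amap (ladj S) (dec (strmap x))) =
      h \<cdot>\<^bsub>A\<^esub> counit S (omap (ladj T) (underlying x))"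
  shows "\<exists>!k. k \<in> hom A (Cod A (q x)) (Cod A h) \<and> k \<cdot>\<^bsub>A\<^esub> q x = h"
  using base.left.cod.coequalizer_factor[OF q_coequalizer[OF assms(1)], of h] assms by auto

lemma next_ladj_omap [simp]: "omap (ladj T') x = Cod A (q x)"
  by (simp add: next_adjn_def next_ladj_def Let_def)

text \<open>Compatibility of \<open>f\<close> with the structure maps is what makes \<open>q (tgt f) \<cdot> L\<^sub>T f\<close> coequalize
  the pair defining \<open>q (src f)\<close>; the definite description in the next left adjoint is therefore
  proper.\<close>

lemma next_ladj_amap:
  assumes f: "f \<in> Arr C'"
  shows "amap (ladj T') f \<in> Arr A" "Dom A (amap (ladj T') f) = Cod A (q (src f))"
    "Cod A (amap (ladj T') f) = Cod A (q (tgt f))"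
    "amap (ladj T') f \<cdot>\<^bsub>A\<^esub> q (src f) = q (tgt f) \<cdot>\<^bsub>A\<^esub> amap (ladj T) (under f)"
proof -
  let ?x = "src f" and ?y = "tgt f" and ?u = "under f"
  let ?L = "ladj S" and ?R = "radj S" and ?L' = "ladj T"
  have xy: "?x \<in> X" "?y \<in> X" and u: "?u \<in> Arr C" "Dom C ?u = underlying ?x"
    "Cod C ?u = underlying ?y" and comm: "comm ?x ?u ?y" using f by auto
  have "(q ?y \<cdot>\<^bsub>A\<^esub> amap ?L' ?u) \<cdot>\<^bsub>A\<^esub> (p (underlying ?x) \<cdot>\<^bsub>A\<^esub> amap ?L (dec (strmap ?x)))
      = q ?y \<cdot>\<^bsub>A\<^esub> (amap ?L' ?u \<cdot>\<^bsub>A\<^esub> (p (underlying ?x) \<cdot>\<^bsub>A\<^esub> amap ?L (dec (strmap ?x))))"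
    using xy u by simp
  also have "amap ?L' ?u \<cdot>\<^bsub>A\<^esub> (p (underlying ?x) \<cdot>\<^bsub>A\<^esub> amap ?L (dec (strmap ?x)))
      = p (underlying ?y) \<cdot>\<^bsub>A\<^esub> (amap ?L (amap U ?u) \<cdot>\<^bsub>A\<^esub> amap ?L (dec (strmap ?x)))"
    using xy u quot_naturality[OF u(1)] by (intro base.left.cod.comp_eq_extend) auto
  also have "amap ?L (amap U ?u) \<cdot>\<^bsub>A\<^esub> amap ?L (dec (strmap ?x)) =
      amap ?L (dec (strmap ?y)) \<cdot>\<^bsub>A\<^esub> amap ?L (amap ?R (amap ?L' ?u))"
    using xy u arg_cong[OF comm, of "amap ?L"] by simp
  also have "q ?y \<cdot>\<^bsub>A\<^esub> (p (underlying ?y) \<cdot>\<^bsub>A\<^esub> (amap ?L (dec (strmap ?y)) \<cdot>\<^bsub>A\<^esub> amap ?L (amap ?R (amap ?L' ?u))))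
      = q ?y \<cdot>\<^bsub>A\<^esub> ((p (underlying ?y) \<cdot>\<^bsub>A\<^esub> amap ?L (dec (strmap ?y))) \<cdot>\<^bsub>A\<^esub> amap ?L (amap ?R (amap ?L' ?u)))"
    using xy u by simp
  also have "\<dots> = q ?y \<cdot>\<^bsub>A\<^esub> (counit S (omap ?L' (underlying ?y)) \<cdot>\<^bsub>A\<^esub> amap ?L (amap ?R (amap ?L' ?u)))"
    using xy u q_coequalizes[OF xy(2)] by (intro base.left.cod.comp_eq_extend) auto
  also have "counit S (omap ?L' (underlying ?y)) \<cdot>\<^bsub>A\<^esub> amap ?L (amap ?R (amap ?L' ?u)) =
      amap ?L' ?u \<cdot>\<^bsub>A\<^esub> counit S (omap ?L' (underlying ?x))"
    using base.counit_naturality[of "amap ?L' ?u"] u by simp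
  finally have "\<exists>!k. k \<in> hom A (Cod A (q ?x)) (Cod A (q ?y)) \<and>
      k \<cdot>\<^bsub>A\<^esub> q ?x = q ?y \<cdot>\<^bsub>A\<^esub> amap ?L' ?u"
    using q_factor[OF xy(1), of "q ?y \<cdot>\<^bsub>A\<^esub> amap ?L' ?u"] xy u by simp
  from theI'[OF this]
  show "amap (ladj T') f \<in> Arr A" "Dom A (amap (ladj T') f) = Cod A (q (src f))"
    "Cod A (amap (ladj T') f) = Cod A (q (tgt f))"
    "amap (ladj T') f \<cdot>\<^bsub>A\<^esub> q (src f) = q (tgt f) \<cdot>\<^bsub>A\<^esub> amap (ladj T) (under f)"
    by (auto simp: next_adjn_def next_ladj_def Let_def)
qed

lemma next_radj_simps [simp]:
  "omap (radj T') a = Str (omap (radj T) a) (r a)"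
  "amap (radj T') f = Mor (Str (omap (radj T) (Dom A f)) (r (Dom A f))) (amap (radj T) f)
     (Str (omap (radj T) (Cod A f)) (r (Cod A f)))"
  by (simp_all add: next_adjn_def next_radj_def Let_def)

lemma next_unit [simp]:
  "unit T' x = Mor x (amap (radj T) (q x) \<cdot>\<^bsub>C\<^esub> unit T (underlying x))
     (Str (omap (radj T) (Cod A (q x))) (r (Cod A (q x))))"
  using next_radj_simps(1) next_ladj_omap by (simp add: next_adjn_def Let_def)

text \<open>The structure map on \<open>R\<^sub>T a\<close> is \<open>R\<^sub>S\<close> of the counit, so naturality of the counit of \<open>S\<close> shows
  that the counit of \<open>T\<close> coequalizes the pair defining \<open>q\<close>.\<close>

lemma next_counit:
  assumes a: "a \<in> Obj A"
  shows "counit T' a \<in> Arr A"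
    "Dom A (counit T' a) = Cod A (q (Str (omap (radj T) a) (r a)))"
    "Cod A (counit T' a) = a"
    "counit T' a \<cdot>\<^bsub>A\<^esub> q (Str (omap (radj T) a) (r a)) = counit T a"
proof -
  let ?x = "Str (omap (radj T) a) (r a)"
  have "counit T a \<cdot>\<^bsub>A\<^esub> (p (omap (radj T) a) \<cdot>\<^bsub>A\<^esub> amap (ladj S) (amap (radj S) (counit T a)))
      = (counit T a \<cdot>\<^bsub>A\<^esub> p (omap (radj T) a)) \<cdot>\<^bsub>A\<^esub> amap (ladj S) (amap (radj S) (counit T a))"
    using a by simp
  also have "\<dots> = counit T a \<cdot>\<^bsub>A\<^esub> counit S (omap (ladj T) (omap (radj T) a))"
    using a base.counit_naturality[of "counit T a"] by (simp add: counit_quot)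
  finally have "\<exists>!k. k \<in> hom A (Cod A (q ?x)) a \<and> k \<cdot>\<^bsub>A\<^esub> q ?x = counit T a"
    using q_factor[of ?x "counit T a"] a by (simp add: dec_radj)
  from theI'[OF this]
  show "counit T' a \<in> Arr A"
    "Dom A (counit T' a) = Cod A (q ?x)" "Cod A (counit T' a) = a"
    "counit T' a \<cdot>\<^bsub>A\<^esub> q ?x = counit T a"
    by (auto simp: next_adjn_def next_ladj_def next_radj_def Let_def)
qed

lemma next_ladj_functor: "is_functor C' A (ladj T')"
proof
  fix x y f assume f: "f \<in> hom C' x y"
  then have "f \<in> Arr C'" "src f = x" "tgt f = y" by auto
  then show "amap (ladj T') f \<in> hom A (omap (ladj T') x) (omap (ladj T') y)"
    using next_ladj_amap(1-3)[of f] by (simp del: structured_category_arr_iff)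
next
  fix x assume x: "x \<in> Obj C'"
  then have "Ide C' x \<in> Arr C'" by (rule C'.arr_ide)
  note L = next_ladj_amap[OF this]
  show "amap (ladj T') (Ide C' x) = Ide A (omap (ladj T') x)"
    by (rule q_cancel[of x]) (use L x in auto)
next
  fix x y z f g assume f: "f \<in> hom C' x y" and g: "g \<in> hom C' y z"
  have f': "f \<in> Arr C'" and g': "g \<in> Arr C'" and "g \<cdot>\<^bsub>C'\<^esub> f \<in> Arr C'"
    using f g C'.comp_hom[OF f g] by auto
  note L = next_ladj_amap[OF f'] next_ladj_amap[OF g'] next_ladj_amap[OF \<open>g \<cdot>\<^bsub>C'\<^esub> f \<in> Arr C'\<close>]
  have xyz: "x \<in> X" "y \<in> X" "z \<in> X" "src f = x" "tgt f = y" "src g = y" "tgt g = z" using f g by auto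
  have u: "under f \<in> hom C (underlying x) (underlying y)" "under g \<in> hom C (underlying y) (underlying z)"
    using f g by auto
  have "amap (ladj T') (g \<cdot>\<^bsub>C'\<^esub> f) \<cdot>\<^bsub>A\<^esub> q x
      = q z \<cdot>\<^bsub>A\<^esub> (amap (ladj T) (under g) \<cdot>\<^bsub>A\<^esub> amap (ladj T) (under f))"
    using L(12) xyz u by simp
  also have "\<dots> = amap (ladj T') g \<cdot>\<^bsub>A\<^esub> (q y \<cdot>\<^bsub>A\<^esub> amap (ladj T) (under f))"
    using L(5-8) xyz u by (intro base.left.cod.comp_eq_extend) auto
  also have "q y \<cdot>\<^bsub>A\<^esub> amap (ladj T) (under f) = amap (ladj T') f \<cdot>\<^bsub>A\<^esub> q x"
    using L(4) xyz by simp
  also have "amap (ladj T') g \<cdot>\<^bsub>A\<^esub> (amap (ladj T') f \<cdot>\<^bsub>A\<^esub> q x) =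
      (amap (ladj T') g \<cdot>\<^bsub>A\<^esub> amap (ladj T') f) \<cdot>\<^bsub>A\<^esub> q x"
    using L(1-3,5-7) xyz by simp
  finally show "amap (ladj T') (g \<cdot>\<^bsub>C'\<^esub> f) = amap (ladj T') g \<cdot>\<^bsub>A\<^esub> amap (ladj T') f"
    by (rule q_cancel[OF xyz(1), rotated -1]) (use L(1-3,5-7,9-11) xyz in simp_all)
qed auto

sublocale L': is_functor C' A "ladj T'" by (rule next_ladj_functor)

lemma next_radj_functor: "is_functor A C' (radj T')"
proof
  fix a b f assume f: "f \<in> hom A a b"
  then show "amap (radj T') f \<in> hom C' (omap (radj T') a) (omap (radj T') b)"
    using arg_cong[OF stage.counit_naturality[of f], of "amap (radj S)"] by (auto simp: dec_radj)
qed auto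

sublocale R': is_functor A C' "radj T'" by (rule next_radj_functor)

text \<open>The next unit respects the structure maps: by the relation between \<open>p\<close> and the units, and
  since \<open>q x\<close> coequalizes its defining pair, both sides reduce to \<open>R\<^sub>S (q x)\<close>.\<close>

lemma adjunct_q_algebra:
  assumes x: "x \<in> X"
  shows "comm x (amap (radj T) (q x) \<cdot>\<^bsub>C\<^esub> unit T (underlying x))
    (Str (omap (radj T) (Cod A (q x))) (r (Cod A (q x))))"
proof -
  let ?v = "underlying x" and ?R = "radj S" and ?b = "dec (strmap x)" and ?c = "Cod A (q x)"
  have "amap U (amap (radj T) (q x) \<cdot>\<^bsub>C\<^esub> unit T ?v) \<cdot>\<^bsub>E\<^esub> ?b
      = amap ?R (q x \<cdot>\<^bsub>A\<^esub> p ?v) \<cdot>\<^bsub>E\<^esub> (unit S (omap U ?v) \<cdot>\<^bsub>E\<^esub> ?b)"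
    using x by (simp add: unit_quot)
  also have "unit S (omap U ?v) \<cdot>\<^bsub>E\<^esub> ?b =
      amap ?R (amap (ladj S) ?b) \<cdot>\<^bsub>E\<^esub> unit S (omap ?R (omap (ladj T) ?v))"
    using x base.unit_naturality[of ?b] by simp
  also have "amap ?R (q x \<cdot>\<^bsub>A\<^esub> p ?v) \<cdot>\<^bsub>E\<^esub> \<dots> =
      amap ?R (q x \<cdot>\<^bsub>A\<^esub> (p ?v \<cdot>\<^bsub>A\<^esub> amap (ladj S) ?b)) \<cdot>\<^bsub>E\<^esub> unit S (omap ?R (omap (ladj T) ?v))"
    using x by simp
  also have "\<dots> = amap ?R (q x) \<cdot>\<^bsub>E\<^esub> (amap ?R (counit S (omap (ladj T) ?v)) \<cdot>\<^bsub>E\<^esub>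
      unit S (omap ?R (omap (ladj T) ?v)))"
    using x by (simp add: q_coequalizes)
  also have "\<dots> = amap ?R (q x)"
    using x by (simp add: base.triangle_right)
  also have "\<dots> = amap ?R (counit T ?c \<cdot>\<^bsub>A\<^esub> amap (ladj T) (amap (radj T) (q x) \<cdot>\<^bsub>C\<^esub> unit T ?v))"
    using x stage.adjunct_of_transpose[of "q x" ?v] by simp
  also have "\<dots> = dec (r ?c) \<cdot>\<^bsub>E\<^esub> amap ?R (amap (ladj T) (amap (radj T) (q x) \<cdot>\<^bsub>C\<^esub> unit T ?v))"
    using x by (simp add: dec_radj)
  finally show ?thesis by simp
qed

lemma next_unit_arr: "x \<in> X \<Longrightarrow> unit T' x \<in> hom C' x (omap (radj T') (omap (ladj T') x))"
  using adjunct_q_algebra[of x] by simp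

text \<open>The equations between arrows out of the next left adjoint are checked after composing with
  the epimorphism \<open>q\<close>, where they reduce to the corresponding equations for \<open>T\<close>.\<close>

theorem next_adjunction: "adjunction A C' T'"
proof
  show "natural_transformation C' C' fident (radj T' \<circ>\<^sub>F ladj T') (unit T')"
    unfolding natural_transformation_iff
  proof (intro conjI ballI)
    fix x assume "x \<in> Obj C'"
    then show "unit T' x \<in> hom C' (omap fident x) (omap (radj T' \<circ>\<^sub>F ladj T') x)"
      using next_unit_arr[of x] by simp
  next
    fix f assume f: "f \<in> Arr C'"
    let ?x = "src f" and ?y = "tgt f" and ?u = "under f"
    have xy: "?x \<in> X" "?y \<in> X" and u: "?u \<in> Arr C" "Dom C ?u = underlying ?x"
      "Cod C ?u = underlying ?y" using f by auto
    note L = next_ladj_amap[OF f]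
    have "(amap (radj T) (q ?y) \<cdot>\<^bsub>C\<^esub> unit T (underlying ?y)) \<cdot>\<^bsub>C\<^esub> ?u =
        amap (radj T) (q ?y) \<cdot>\<^bsub>C\<^esub> (amap (radj T) (amap (ladj T) ?u) \<cdot>\<^bsub>C\<^esub> unit T (underlying ?x))"
      using xy u stage.unit_naturality[OF u(1)] by simp
    also have "\<dots> = amap (radj T) (amap (ladj T') f) \<cdot>\<^bsub>C\<^esub> (amap (radj T) (q ?x) \<cdot>\<^bsub>C\<^esub> unit T (underlying ?x))"
      using xy u L(1-3) arg_cong[OF L(4), of "amap (radj T)"]
      by (intro stage.left.dom.comp_eq_extend) auto
    finally show "unit T' (Cod C' f) \<cdot>\<^bsub>C'\<^esub> amap fident f =
        amap (radj T' \<circ>\<^sub>F ladj T') f \<cdot>\<^bsub>C'\<^esub> unit T' (Dom C' f)"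
      using L f by simp
  qed
  show "natural_transformation A A (ladj T' \<circ>\<^sub>F radj T') fident (counit T')"
    unfolding natural_transformation_iff
  proof (intro conjI ballI)
    fix a assume "a \<in> Obj A"
    then show "counit T' a \<in> hom A (omap (ladj T' \<circ>\<^sub>F radj T') a) (omap fident a)"
      using next_counit[of a] by simp
  next
    fix g assume g: "g \<in> Arr A"
    let ?a = "Dom A g" and ?b = "Cod A g"
    let ?x = "omap (radj T') ?a" and ?y = "omap (radj T') ?b"
    have Rg: "amap (radj T') g \<in> Arr C'" using g by (rule R'.amap_arr)
    have xy: "?x \<in> X" "?y \<in> X" using g by simp_all
    have ab: "?a \<in> Obj A" "?b \<in> Obj A" using g by simp_all
    note L = next_ladj_amap[OF Rg] and e = next_counit[OF ab(1)] next_counit[OF ab(2)]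
    have "(counit T' ?b \<cdot>\<^bsub>A\<^esub> amap (ladj T') (amap (radj T') g)) \<cdot>\<^bsub>A\<^esub> q ?x =
        counit T' ?b \<cdot>\<^bsub>A\<^esub> (q ?y \<cdot>\<^bsub>A\<^esub> amap (ladj T) (amap (radj T) g))"
      using L e(5-7) xy by simp
    also have "\<dots> = (counit T' ?b \<cdot>\<^bsub>A\<^esub> q ?y) \<cdot>\<^bsub>A\<^esub> amap (ladj T) (amap (radj T) g)"
      by (rule base.left.cod.comp_assoc_arr[symmetric]) (use e(5-7) g xy in simp_all)
    also have "counit T' ?b \<cdot>\<^bsub>A\<^esub> q ?y = counit T ?b"
      using e(8) g by simp
    also have "\<dots> \<cdot>\<^bsub>A\<^esub> amap (ladj T) (amap (radj T) g) = g \<cdot>\<^bsub>A\<^esub> counit T ?a"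
      by (rule stage.counit_naturality[OF g])
    also have "counit T ?a = counit T' ?a \<cdot>\<^bsub>A\<^esub> q ?x"
      using e(4) g by simp
    also have "g \<cdot>\<^bsub>A\<^esub> (counit T' ?a \<cdot>\<^bsub>A\<^esub> q ?x) = (g \<cdot>\<^bsub>A\<^esub> counit T' ?a) \<cdot>\<^bsub>A\<^esub> q ?x"
      by (rule base.left.cod.comp_assoc_arr[symmetric]) (use e(1-3) g xy in simp_all)
    finally have "counit T' ?b \<cdot>\<^bsub>A\<^esub> amap (ladj T') (amap (radj T') g) = g \<cdot>\<^bsub>A\<^esub> counit T' ?a"
      by (rule q_cancel[OF xy(1), rotated -1]) (use L(1-3) e(1-3,5-7) g in simp_all)
    then show "counit T' ?b \<cdot>\<^bsub>A\<^esub> amap (ladj T' \<circ>\<^sub>F radj T') g = amap fident g \<cdot>\<^bsub>A\<^esub> counit T' ?a"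
      by simp
  qed
next
  fix x assume "x \<in> Obj C'"
  then have x: "x \<in> X" by simp
  let ?c = "Cod A (q x)" and ?v = "underlying x"
  have c: "?c \<in> Obj A" using x by simp
  have n: "unit T' x \<in> Arr C'" using next_unit_arr[OF x] by (simp only: in_hom_iff)
  note L = next_ladj_amap[OF n] and e = next_counit[OF c]
  have "(counit T' ?c \<cdot>\<^bsub>A\<^esub> amap (ladj T') (unit T' x)) \<cdot>\<^bsub>A\<^esub> q x =
      counit T' ?c \<cdot>\<^bsub>A\<^esub> (q (omap (radj T') ?c) \<cdot>\<^bsub>A\<^esub> amap (ladj T) (amap (radj T) (q x) \<cdot>\<^bsub>C\<^esub> unit T ?v))"
    using L e(1-3) x by simp
  also have "\<dots> = (counit T' ?c \<cdot>\<^bsub>A\<^esub> q (omap (radj T') ?c)) \<cdot>\<^bsub>A\<^esub> amap (ladj T) (amap (radj T) (q x) \<cdot>\<^bsub>C\<^esub> unit T ?v)"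
    by (rule base.left.cod.comp_assoc_arr[symmetric]) (use e(1-3) x in simp_all)
  also have "counit T' ?c \<cdot>\<^bsub>A\<^esub> q (omap (radj T') ?c) = counit T ?c"
    using e(4) by simp
  also have "\<dots> \<cdot>\<^bsub>A\<^esub> amap (ladj T) (amap (radj T) (q x) \<cdot>\<^bsub>C\<^esub> unit T ?v) = q x"
    using x by (intro stage.adjunct_of_transpose) simp_all
  also have "\<dots> = Ide A ?c \<cdot>\<^bsub>A\<^esub> q x" using x by simp
  finally have "counit T' ?c \<cdot>\<^bsub>A\<^esub> amap (ladj T') (unit T' x) = Ide A ?c"
    by (rule q_cancel[OF x, rotated -1]) (use L(1-3) e(1-3) x in simp_all)
  then show "counit T' (omap (ladj T') x) \<cdot>\<^bsub>A\<^esub> amap (ladj T') (unit T' x) = Ide A (omap (ladj T') x)"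
    by simp
next
  fix a assume a: "a \<in> Obj A"
  let ?x = "Str (omap (radj T) a) (r a)"
  note e = next_counit[OF a]
  have "amap (radj T) (counit T' a) \<cdot>\<^bsub>C\<^esub> (amap (radj T) (q ?x) \<cdot>\<^bsub>C\<^esub> unit T (omap (radj T) a)) =
      amap (radj T) (counit T' a \<cdot>\<^bsub>A\<^esub> q ?x) \<cdot>\<^bsub>C\<^esub> unit T (omap (radj T) a)"
    using e(1-3) a by simp
  also have "\<dots> = Ide C (omap (radj T) a)"
    using e a by (simp add: stage.triangle_right)
  finally show "amap (radj T') (counit T' a) \<cdot>\<^bsub>C'\<^esub> unit T' (omap (radj T') a) = Ide C' (omap (radj T') a)"
    using e a by simp
qed


text \<open>The invariant passes to the next stage over the same base, so the step can be iterated.\<close>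

theorem next_stage_over:
  "stage_over A E S C' T' (U \<circ>\<^sub>F forget) (\<lambda>x. q x \<cdot>\<^bsub>A\<^esub> p (underlying x))"
proof -
  interpret T': adjunction A C' T' by (rule next_adjunction)
  interpret UF: is_functor C' E "U \<circ>\<^sub>F forget"
    by (rule is_functor_fcomp) (rule forget.is_functor_axioms U.is_functor_axioms)+
  show ?thesis
  proof unfold_locales
    show "natural_transformation C' A (ladj S \<circ>\<^sub>F U \<circ>\<^sub>F forget) (ladj T')
        (\<lambda>x. q x \<cdot>\<^bsub>A\<^esub> p (underlying x))"
      unfolding natural_transformation_iff
    proof (intro conjI ballI)
      fix f assume f: "f \<in> Arr C'"
      let ?x = "src f" and ?y = "tgt f" and ?u = "under f"
      have xy: "?x \<in> X" "?y \<in> X" and u: "?u \<in> Arr C" "Dom C ?u = underlying ?x"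
        "Cod C ?u = underlying ?y" using f by auto
      note L = next_ladj_amap[OF f]
      have "(q ?y \<cdot>\<^bsub>A\<^esub> p (underlying ?y)) \<cdot>\<^bsub>A\<^esub> amap (ladj S) (amap U ?u) =
          q ?y \<cdot>\<^bsub>A\<^esub> (amap (ladj T) ?u \<cdot>\<^bsub>A\<^esub> p (underlying ?x))"
        using xy u quot_naturality[OF u(1)] by simp
      also have "\<dots> = amap (ladj T') f \<cdot>\<^bsub>A\<^esub> (q ?x \<cdot>\<^bsub>A\<^esub> p (underlying ?x))"
        using xy u L by (intro base.left.cod.comp_eq_extend) simp_all
      finally show "(q (Cod C' f) \<cdot>\<^bsub>A\<^esub> p (underlying (Cod C' f))) \<cdot>\<^bsub>A\<^esub> amap (ladj S \<circ>\<^sub>F U \<circ>\<^sub>F forget) f =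
          amap (ladj T') f \<cdot>\<^bsub>A\<^esub> (q (Dom C' f) \<cdot>\<^bsub>A\<^esub> p (underlying (Dom C' f)))"
        by simp
    qed simp
  next
    fix a assume a: "a \<in> Obj A"
    let ?x = "Str (omap (radj T) a) (r a)"
    note e = next_counit[OF a]
    have "counit T' a \<cdot>\<^bsub>A\<^esub> (q ?x \<cdot>\<^bsub>A\<^esub> p (omap (radj T) a)) =
        (counit T' a \<cdot>\<^bsub>A\<^esub> q ?x) \<cdot>\<^bsub>A\<^esub> p (omap (radj T) a)"
      using e(1-3) a by simp
    also have "\<dots> = counit S a" using a e(4) by (simp add: counit_quot)
    finally show "counit T' a \<cdot>\<^bsub>A\<^esub> (q (omap (radj T') a) \<cdot>\<^bsub>A\<^esub> p (underlying (omap (radj T') a))) =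
        counit S a" by simp
  qed (simp_all add: unit_quot)
qed

end

section \<open>The stages of the two towers\<close>

lemma tagged_category_simps [simp]:
  "Obj (tagged_category B) = Base ` Obj B"
  "Arr (tagged_category B) = BaseArr ` Arr B"
  "Dom (tagged_category B) f = Base (Dom B (untag_arr f))"
  "Cod (tagged_category B) f = Base (Cod B (untag_arr f))"
  "Ide (tagged_category B) x = BaseArr (Ide B (untag_obj x))"
  "g \<cdot>\<^bsub>tagged_category B\<^esub> f = BaseArr (untag_arr g \<cdot>\<^bsub>B\<^esub> untag_arr f)"
  by (simp_all add: tagged_category_def)

lemma tagged_adjn_simps [simp]:
  "omap (ladj (tagged_adjn S)) x = omap (ladj S) (untag_obj x)"
  "amap (ladj (tagged_adjn S)) f = amap (ladj S) (untag_arr f)"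
  "omap (radj (tagged_adjn S)) a = Base (omap (radj S) a)"
  "amap (radj (tagged_adjn S)) g = BaseArr (amap (radj S) g)"
  "unit (tagged_adjn S) x = BaseArr (unit S (untag_obj x))"
  "counit (tagged_adjn S) a = counit S a"
  by (simp_all add: tagged_adjn_def tag_def untag_def)

lemma untag_simps [simp]: "omap untag x = untag_obj x" "amap untag f = untag_arr f"
  by (simp_all add: untag_def)

lemma category_tagged:
  assumes "category B" shows "category (tagged_category B)"
proof -
  interpret category B by fact
  show ?thesis by unfold_locales auto
qed

lemma stage_over_tagged:
  assumes "adjunction A B S"
  shows "stage_over A B S (tagged_category B) (tagged_adjn S) untag
    (\<lambda>x. Ide A (omap (ladj S) (untag_obj x)))"
proof -
  interpret S: adjunction A B S by fact
  interpret B': category "tagged_category B" by (rule category_tagged) (rule S.left.dom.category_axioms)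
  interpret U: is_functor "tagged_category B" B untag by unfold_locales auto
  interpret L: is_functor "tagged_category B" A "ladj (tagged_adjn S)" by unfold_locales auto
  interpret R: is_functor A "tagged_category B" "radj (tagged_adjn S)" by unfold_locales auto
  show ?thesis
    by unfold_locales
      (auto simp: natural_transformation_iff S.unit_naturality S.counit_naturality
        S.triangle_left S.triangle_right)
qed

lemma next_decomp_stage_simps [simp]:
  "cat (next_decomp_stage A coeq B S D) = decomp_category B S D"
  "to_base (next_decomp_stage A coeq B S D) = to_base D \<circ>\<^sub>F forget"
  "adj (next_decomp_stage A coeq B S D) = next_adjn A (cat D) (adj D)
     (\<lambda>a. BaseArr (amap (radj S) (counit (adj D) a))) (decomp_coeq A coeq S D)"
  "quot (next_decomp_stage A coeq B S D) =
     (\<lambda>x. decomp_coeq A coeq S D x \<cdot>\<^bsub>A\<^esub> quot D (underlying x))"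
  by (simp_all add: next_decomp_stage_def Let_def)

lemma next_monadic_stage_simps [simp]:
  "cat (next_monadic_stage A coeq M) = eilenberg_moore (cat M) (induced_monad (adj M))"
  "to_base (next_monadic_stage A coeq M) = to_base M \<circ>\<^sub>F forget"
  "adj (next_monadic_stage A coeq M) = next_adjn A (cat M) (adj M)
     (\<lambda>a. amap (radj (adj M)) (counit (adj M) a)) (monadic_coeq coeq (adj M))"
  by (simp_all add: next_monadic_stage_def)

lemma decomp_obj_iff:
  "x \<in> Obj (decomp_category B S D) \<longleftrightarrow> (\<exists>v b. x = Str v (BaseArr b) \<and> v \<in> Obj (cat D) \<and>
     b \<in> hom B (omap (radj S) (omap (ladj (adj D)) v)) (omap (to_base D) v))"
  by (auto simp: decomp_category_def)

lemma eilenberg_moore_obj_iff: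
  "x \<in> Obj (eilenberg_moore C (induced_monad T)) \<longleftrightarrow> (\<exists>v \<mu>. x = Str v \<mu> \<and> v \<in> Obj C \<and>
     \<mu> \<in> hom C (omap (radj T) (omap (ladj T) v)) v \<and> \<mu> \<cdot>\<^bsub>C\<^esub> unit T v = Ide C v \<and>
     \<mu> \<cdot>\<^bsub>C\<^esub> amap (radj T) (amap (ladj T) \<mu>) =
     \<mu> \<cdot>\<^bsub>C\<^esub> amap (radj T) (counit T (omap (ladj T) v)))"
  by (auto simp: eilenberg_moore_def induced_monad_def)

lemma eilenberg_moore_laws:
  assumes "x \<in> Obj (eilenberg_moore C (induced_monad T))"
  shows "strmap x \<cdot>\<^bsub>C\<^esub> unit T (underlying x) = Ide C (underlying x)"
    "strmap x \<cdot>\<^bsub>C\<^esub> amap (radj T) (amap (ladj T) (strmap x)) =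
     strmap x \<cdot>\<^bsub>C\<^esub> amap (radj T) (counit T (omap (ladj T) (underlying x)))"
  using assms by (auto simp: eilenberg_moore_obj_iff)

text \<open>The next two equations put the compatibility conditions into the form used by
  \<open>structured_step\<close>; for algebras this means taking \<open>fident\<close> as functor to the base.\<close>

lemma decomp_category_eq:
  "decomp_category B S D = structured_category (cat D) (Obj (decomp_category B S D))
     (\<lambda>x f y. amap (to_base D) f \<cdot>\<^bsub>B\<^esub> untag_arr (strmap x) =
              untag_arr (strmap y) \<cdot>\<^bsub>B\<^esub> amap (radj S) (amap (ladj (adj D)) f))"
  by (simp add: decomp_category_def)

lemma eilenberg_moore_eq:
  "eilenberg_moore C (induced_monad T) =
    structured_category C (Obj (eilenberg_moore C (induced_monad T)))
      (\<lambda>x f y. amap fident f \<cdot>\<^bsub>C\<^esub> strmap x = strmap y \<cdot>\<^bsub>C\<^esub> amap (radj T) (amap (ladj T) f))"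
  by (simp add: eilenberg_moore_def induced_monad_def)

lemma chosen_coequalizersD:
  assumes "chosen_coequalizers C coeq" "f \<in> Arr C" "g \<in> Arr C" "Dom C g = Dom C f" "Cod C g = Cod C f"
  shows "coequalizer C f g (coeq f g)"
  using assms by (auto simp: chosen_coequalizers_def)

lemma structured_step_decomp:
  assumes "stage_over A B S (cat D) (adj D) (to_base D) (quot D)"
    and coeq: "chosen_coequalizers A coeq"
  shows "structured_step A B S (cat D) (adj D) (to_base D) (quot D) untag_arr
    (Obj (decomp_category B S D)) (\<lambda>a. BaseArr (amap (radj S) (counit (adj D) a)))
    (decomp_coeq A coeq S D)"
proof -
  interpret D: stage_over A B S "cat D" "adj D" "to_base D" "quot D" by fact
  show ?thesis
  proof unfold_locales
    fix x assume "x \<in> Obj (decomp_category B S D)"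
    then show "coequalizer A (quot D (underlying x) \<cdot>\<^bsub>A\<^esub> amap (ladj S) (untag_arr (strmap x)))
        (counit S (omap (ladj (adj D)) (underlying x))) (decomp_coeq A coeq S D x)"
      unfolding decomp_coeq_def
      by (intro chosen_coequalizersD[OF coeq]) (auto simp: decomp_obj_iff)
  qed (auto simp: decomp_obj_iff)
qed

text \<open>Here the identities play the role of \<open>\<pi>\<close>, which turns the coequalizer of the adjoint
  decomposition into that of the monadic tower.\<close>

lemma structured_step_monadic:
  fixes T :: "('ao, 'am, ('o, 'm) tobj, ('o, 'm) tarr) adjn"
  assumes "adjunction A C T" and coeq: "chosen_coequalizers A coeq"
  shows "structured_step A C T C T fident (\<lambda>x. Ide A (omap (ladj T) x)) (\<lambda>b. b)
    (Obj (eilenberg_moore C (induced_monad T))) (\<lambda>a. amap (radj T) (counit T a))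
    (monadic_coeq coeq T)"
proof -
  interpret T: stage_over A C T C T fident "\<lambda>x. Ide A (omap (ladj T) x)"
    by (rule stage_over_self) fact
  show ?thesis
  proof unfold_locales
    fix a assume a: "a \<in> Obj A"
    then show "Str (omap (radj T) a) (amap (radj T) (counit T a)) \<in> Obj (eilenberg_moore C (induced_monad T))"
      using T.base.triangle_right[OF a]
        arg_cong[OF T.base.counit_naturality[of "counit T a"], of "amap (radj T)"]
      by (simp add: eilenberg_moore_obj_iff)
  next
    fix x assume "x \<in> Obj (eilenberg_moore C (induced_monad T))"
    then show "coequalizer A (Ide A (omap (ladj T) (underlying x)) \<cdot>\<^bsub>A\<^esub> amap (ladj T) (strmap x))
        (counit T (omap (ladj T) (underlying x))) (monadic_coeq coeq T x)"
      unfolding monadic_coeq_def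
      by (auto simp: eilenberg_moore_obj_iff
        intro!: chosen_coequalizersD[OF coeq])
  qed (auto simp: eilenberg_moore_obj_iff)
qed


section \<open>Comparison of the towers\<close>

text \<open>The induction hypothesis on a stage \<open>M\<close> of the monadic tower, a stage \<open>D\<close> of the adjoint
  decomposition and the functor \<open>K\<close> between them. Faithfulness over \<open>B\<close> makes the arrow given by
  \<open>mono_lift\<close> unique and its triangle commute, so that condition says that arrows with monic image
  in \<open>B\<close> are cartesian over \<open>B\<close>.\<close>

locale tower_comparison =
  high: stage_over A B S "cat D" "adj D" "to_base D" "quot D" +
  low: adjunction A "cat M" "adj M" +
  V: is_functor "cat M" B "to_base M" +
  K: is_functor "cat M" "cat D" K
  for A :: "('ao, 'am) category" and B :: "('o, 'm) category" and S
    and M :: "('ao, 'am, 'o, 'm) stage" and D :: "('ao, 'am, 'o, 'm) decomp_stage" and K +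
  assumes full: "v \<in> Obj (cat M) \<Longrightarrow> w \<in> Obj (cat M) \<Longrightarrow> g \<in> hom (cat D) (omap K v) (omap K w) \<Longrightarrow>
      \<exists>f \<in> hom (cat M) v w. amap K f = g"
    and faithful: "f \<in> hom (cat M) v w \<Longrightarrow> g \<in> hom (cat M) v w \<Longrightarrow> amap K f = amap K g \<Longrightarrow> f = g"
    and injective: "v \<in> Obj (cat M) \<Longrightarrow> w \<in> Obj (cat M) \<Longrightarrow> omap K v = omap K w \<Longrightarrow> v = w"
    and K_radj_obj [simp]: "a \<in> Obj A \<Longrightarrow> omap K (omap (radj (adj M)) a) = omap (radj (adj D)) a"
    and K_radj_arr [simp]: "e \<in> Arr A \<Longrightarrow> amap K (amap (radj (adj M)) e) = amap (radj (adj D)) e"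
    and base_K_obj [simp]: "v \<in> Obj (cat M) \<Longrightarrow> omap (to_base D) (omap K v) = omap (to_base M) v"
    and base_K_arr [simp]: "f \<in> Arr (cat M) \<Longrightarrow> amap (to_base D) (amap K f) = amap (to_base M) f"
    and base_faithful: "f \<in> hom (cat M) v w \<Longrightarrow> g \<in> hom (cat M) v w \<Longrightarrow>
      amap (to_base M) f = amap (to_base M) g \<Longrightarrow> f = g"
    and mono_lift: "f \<in> hom (cat M) v w \<Longrightarrow> monomorphism B (amap (to_base M) f) \<Longrightarrow>
      g \<in> hom (cat M) u w \<Longrightarrow> h \<in> hom B (omap (to_base M) u) (omap (to_base M) v) \<Longrightarrow>
      amap (to_base M) f \<cdot>\<^bsub>B\<^esub> h = amap (to_base M) g \<Longrightarrow>
      \<exists>k \<in> hom (cat M) u v. amap (to_base M) k = h"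
    and mono_closed: "w \<in> Obj (cat M) \<Longrightarrow> f \<in> hom (cat D) d (omap K w) \<Longrightarrow>
      monomorphism B (amap (to_base D) f) \<Longrightarrow> d \<in> omap K ` Obj (cat M)"
begin

lemma base_radj_obj [simp]:
  assumes "a \<in> Obj A"
  shows "omap (to_base M) (omap (radj (adj M)) a) = omap (radj S) a"
  using base_K_obj[of "omap (radj (adj M)) a", symmetric] assms by (simp del: base_K_obj)

lemma base_radj_arr [simp]:
  assumes "g \<in> Arr A"
  shows "amap (to_base M) (amap (radj (adj M)) g) = amap (radj S) g"
  using base_K_arr[of "amap (radj (adj M)) g", symmetric] assms by (simp del: base_K_arr)

lemma base_mono_cancel:
  assumes "f \<in> Arr (cat M)" "monomorphism B (amap (to_base M) f)"
    "g \<in> hom (cat M) u (Dom (cat M) f)" "h \<in> hom (cat M) u (Dom (cat M) f)"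
    "f \<cdot>\<^bsub>cat M\<^esub> g = f \<cdot>\<^bsub>cat M\<^esub> h"
  shows "g = h"
proof -
  have "amap (to_base M) f \<cdot>\<^bsub>B\<^esub> amap (to_base M) g = amap (to_base M) f \<cdot>\<^bsub>B\<^esub> amap (to_base M) h"
    using assms V.amap_comp_eq[of g f] V.amap_comp_eq[of h f] by auto
  then have "amap (to_base M) g = amap (to_base M) h"
    by (rule high.base.left.dom.monomorphism_cancel[OF assms(2), rotated -1]) (use assms in auto)
  then show ?thesis by (rule base_faithful[OF assms(3,4)])
qed

subsection \<open>The isomorphism of left adjoints\<close>

abbreviation l where "l \<equiv> lam A M D K"

lemma lam_arr [simp]:
  assumes "v \<in> Obj (cat M)"
  shows "l v \<in> Arr A" "Dom A (l v) = omap (ladj (adj D)) (omap K v)"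
    "Cod A (l v) = omap (ladj (adj M)) v"
  using assms by (simp_all add: lam_def)

text \<open>This equation characterises \<open>l v\<close>, the transpose of \<open>K \<eta> : K v \<rightarrow> K (R L v)\<close> under the
  adjunction of \<open>D\<close>.\<close>

lemma lam_transpose:
  assumes "v \<in> Obj (cat M)"
  shows "amap (radj (adj D)) (l v) \<cdot>\<^bsub>cat D\<^esub> unit (adj D) (omap K v) = amap K (unit (adj M) v)"
  using high.stage.transpose_of_adjunct[of "amap K (unit (adj M) v)" "omap (ladj (adj M)) v"] assms
  by (simp add: lam_def)

text \<open>By fullness the unit of \<open>D\<close> at \<open>K v\<close> is \<open>K k\<close> for some \<open>k\<close>, since its codomain is a value of
  \<open>K\<close> on the right adjoint of \<open>M\<close>. The transpose of \<open>k\<close> is the inverse: both composites are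
  identified by their transposes.\<close>

lemma lam_isomorphism:
  assumes v: "v \<in> Obj (cat M)"
  shows "isomorphism A (l v)"
proof -
  let ?L = "ladj (adj M)" and ?R = "radj (adj M)" and ?\<eta> = "unit (adj M)"
  let ?L' = "ladj (adj D)" and ?R' = "radj (adj D)" and ?\<eta>' = "unit (adj D)"
  let ?a = "omap ?L' (omap K v)"
  have a: "?a \<in> Obj A" using v by simp
  obtain k where k: "k \<in> hom (cat M) v (omap ?R ?a)" "amap K k = ?\<eta>' (omap K v)"
    using full[of v "omap ?R ?a" "?\<eta>' (omap K v)"] v a by auto
  define t where "t = counit (adj M) ?a \<cdot>\<^bsub>A\<^esub> amap ?L k"
  have t: "t \<in> Arr A" "Dom A t = omap ?L v" "Cod A t = ?a"
    using k(1) a by (simp_all add: t_def)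
  have Rt: "amap ?R t \<cdot>\<^bsub>cat M\<^esub> ?\<eta> v = k"
    using low.transpose_of_adjunct[of k ?a] k(1) a unfolding t_def by auto
  have "amap K (amap ?R (l v) \<cdot>\<^bsub>cat M\<^esub> k) = amap ?R' (l v) \<cdot>\<^bsub>cat D\<^esub> ?\<eta>' (omap K v)"
    using v k by simp
  also have "\<dots> = amap K (?\<eta> v)" by (rule lam_transpose[OF v])
  finally have Rk: "amap ?R (l v) \<cdot>\<^bsub>cat M\<^esub> k = ?\<eta> v"
    by (rule faithful[rotated 2]) (use v k(1) in auto)
  have "amap ?R (l v \<cdot>\<^bsub>A\<^esub> t) \<cdot>\<^bsub>cat M\<^esub> ?\<eta> v = amap ?R (l v) \<cdot>\<^bsub>cat M\<^esub> (amap ?R t \<cdot>\<^bsub>cat M\<^esub> ?\<eta> v)"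
    using v t by simp
  also have "\<dots> = amap ?R (Ide A (omap ?L v)) \<cdot>\<^bsub>cat M\<^esub> ?\<eta> v"
    using v by (simp add: Rt Rk)
  finally have lt: "l v \<cdot>\<^bsub>A\<^esub> t = Ide A (omap ?L v)"
    by (rule low.transpose_inject[rotated -1]) (use v t in auto)
  have "amap ?R' (t \<cdot>\<^bsub>A\<^esub> l v) \<cdot>\<^bsub>cat D\<^esub> ?\<eta>' (omap K v) =
      amap ?R' t \<cdot>\<^bsub>cat D\<^esub> (amap ?R' (l v) \<cdot>\<^bsub>cat D\<^esub> ?\<eta>' (omap K v))"
    using v t by simp
  also have "\<dots> = amap K (amap ?R t \<cdot>\<^bsub>cat M\<^esub> ?\<eta> v)"
    using v t by (simp add: lam_transpose)
  also have "\<dots> = amap ?R' (Ide A ?a) \<cdot>\<^bsub>cat D\<^esub> ?\<eta>' (omap K v)"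
    using v by (simp add: Rt k(2))
  finally have tl: "t \<cdot>\<^bsub>A\<^esub> l v = Ide A ?a"
    by (rule high.stage.transpose_inject[rotated -1]) (use v t in auto)
  show ?thesis
    unfolding isomorphism_def using v t lt tl by (auto intro!: bexI[of _ t])
qed

lemma lam_naturality:
  assumes f: "f \<in> hom (cat M) v w"
  shows "l w \<cdot>\<^bsub>A\<^esub> amap (ladj (adj D)) (amap K f) = amap (ladj (adj M)) f \<cdot>\<^bsub>A\<^esub> l v"
proof -
  let ?L = "ladj (adj M)" and ?R = "radj (adj M)" and ?\<eta> = "unit (adj M)"
  let ?L' = "ladj (adj D)" and ?R' = "radj (adj D)" and ?\<eta>' = "unit (adj D)"
  have vw: "v \<in> Obj (cat M)" "w \<in> Obj (cat M)" using f by auto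
  have "amap ?R' (l w \<cdot>\<^bsub>A\<^esub> amap ?L' (amap K f)) \<cdot>\<^bsub>cat D\<^esub> ?\<eta>' (omap K v)
      = amap ?R' (l w) \<cdot>\<^bsub>cat D\<^esub> (?\<eta>' (omap K w) \<cdot>\<^bsub>cat D\<^esub> amap K f)"
    using f vw high.stage.unit_naturality[of "amap K f"] by auto
  also have "\<dots> = (amap ?R' (l w) \<cdot>\<^bsub>cat D\<^esub> ?\<eta>' (omap K w)) \<cdot>\<^bsub>cat D\<^esub> amap K f"
    using f vw by auto
  also have "\<dots> = amap K (?\<eta> w \<cdot>\<^bsub>cat M\<^esub> f)"
    unfolding lam_transpose[OF vw(2)] using f vw by auto
  also have "?\<eta> w \<cdot>\<^bsub>cat M\<^esub> f = amap ?R (amap ?L f) \<cdot>\<^bsub>cat M\<^esub> ?\<eta> v"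
    using f low.unit_naturality[of f] by auto
  also have "amap K \<dots> = amap ?R' (amap ?L f) \<cdot>\<^bsub>cat D\<^esub> (amap ?R' (l v) \<cdot>\<^bsub>cat D\<^esub> ?\<eta>' (omap K v))"
    unfolding lam_transpose[OF vw(1)] using f vw by auto
  also have "\<dots> = amap ?R' (amap ?L f \<cdot>\<^bsub>A\<^esub> l v) \<cdot>\<^bsub>cat D\<^esub> ?\<eta>' (omap K v)"
    using f vw by auto
  finally show ?thesis
    by (rule high.stage.transpose_inject[rotated -1]) (use f vw in auto)
qed

lemma counit_lam:
  assumes a: "a \<in> Obj A"
  shows "counit (adj M) a \<cdot>\<^bsub>A\<^esub> l (omap (radj (adj M)) a) = counit (adj D) a"
proof -
  let ?L = "ladj (adj M)" and ?R = "radj (adj M)" and ?R' = "radj (adj D)" and ?\<eta>' = "unit (adj D)"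
  let ?v = "omap ?R a"
  have "amap ?R' (counit (adj M) a \<cdot>\<^bsub>A\<^esub> l ?v) \<cdot>\<^bsub>cat D\<^esub> ?\<eta>' (omap K ?v) =
      amap ?R' (counit (adj M) a) \<cdot>\<^bsub>cat D\<^esub> (amap ?R' (l ?v) \<cdot>\<^bsub>cat D\<^esub> ?\<eta>' (omap K ?v))"
    using a by simp
  also have "\<dots> = amap K (amap ?R (counit (adj M) a) \<cdot>\<^bsub>cat M\<^esub> unit (adj M) ?v)"
    using a lam_transpose[of ?v] by simp
  also have "\<dots> = amap ?R' (counit (adj D) a) \<cdot>\<^bsub>cat D\<^esub> ?\<eta>' (omap K ?v)"
    using a by (simp add: low.triangle_right high.stage.triangle_right)
  finally show ?thesis
    by (rule high.stage.transpose_inject[rotated -1]) (use a in auto)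
qed

lemma radj_lam_isomorphism:
  "v \<in> Obj (cat M) \<Longrightarrow> isomorphism B (amap (radj S) (l v))"
  by (intro high.base.right.isomorphism_amap lam_isomorphism)

subsection \<open>Lifting along the comparison functor\<close>

text \<open>A factorisation \<open>h\<close> of \<open>K g\<close> through \<open>K f\<close> is some \<open>K k\<close> by fullness, and faithfulness
  reflects the triangle.\<close>

lemma arr_cartesian:
  assumes f: "f \<in> Arr (cat M)"
  shows "cartesian_over (cat M) (cat D) K f (amap K f)"
  unfolding cartesian_over_def
proof (intro conjI ballI impI)
  fix g h
  assume g: "g \<in> Arr (cat M)" and h: "h \<in> hom (cat D) (omap K (Dom (cat M) g)) (omap K (Dom (cat M) f))"
    and cod: "Cod (cat M) g = Cod (cat M) f" and eq: "amap K f \<cdot>\<^bsub>cat D\<^esub> h = amap K g"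
  from full[OF _ _ h] f g obtain k
    where k: "k \<in> hom (cat M) (Dom (cat M) g) (Dom (cat M) f)" "amap K k = h" by auto
  have "amap K (f \<cdot>\<^bsub>cat M\<^esub> k) = amap K g" using f k eq by auto
  then have "f \<cdot>\<^bsub>cat M\<^esub> k = g" by (rule faithful[rotated 2]) (use f g k(1) cod in auto)
  then show "\<exists>!k. k \<in> hom (cat M) (Dom (cat M) g) (Dom (cat M) f) \<and> amap K k = h \<and> f \<cdot>\<^bsub>cat M\<^esub> k = g"
    using k faithful by (intro ex1I[of _ k]) blast+
qed (use f in auto)

lemma mono_arr_lift:
  assumes w: "w \<in> Obj (cat M)" and f: "f \<in> Arr (cat D)" "Cod (cat D) f = omap K w"
    and mono: "monomorphism B (amap (to_base D) f)"
  obtains g where "g \<in> Arr (cat M)" "Cod (cat M) g = w" "amap K g = f"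
proof -
  have fh: "f \<in> hom (cat D) (Dom (cat D) f) (omap K w)" using f by simp
  from mono_closed[OF w fh mono] obtain v where v: "v \<in> Obj (cat M)" "Dom (cat D) f = omap K v" by blast
  from fh full[OF v(1) w, of f] v(2) obtain g where "g \<in> hom (cat M) v w" "amap K g = f" by auto
  then show thesis using that by auto
qed

lemma iso_arr_lift:
  assumes w: "w \<in> Obj (cat M)" and f: "isomorphism (cat D) f" "Cod (cat D) f = omap K w"
  obtains g where "g \<in> Arr (cat M)" "Cod (cat M) g = w" "amap K g = f"
proof (rule mono_arr_lift[OF w _ f(2)])
  show "f \<in> Arr (cat D)" using f(1) by (simp add: isomorphism_def)
  show "monomorphism B (amap (to_base D) f)"
    by (intro high.base.left.dom.isomorphism_monomorphism high.U.isomorphism_amap f(1))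
qed (rule that)

lemma isomorphism_reflect:
  assumes f: "f \<in> Arr (cat M)" and iso: "isomorphism (cat D) (amap K f)"
  shows "isomorphism (cat M) f"
proof -
  let ?v = "Dom (cat M) f" and ?w = "Cod (cat M) f"
  obtain h where h: "h \<in> hom (cat D) (omap K ?w) (omap K ?v)"
    "h \<cdot>\<^bsub>cat D\<^esub> amap K f = Ide (cat D) (omap K ?v)" "amap K f \<cdot>\<^bsub>cat D\<^esub> h = Ide (cat D) (omap K ?w)"
    using f iso by (auto simp: isomorphism_def)
  from full[OF _ _ h(1)] f obtain g where g: "g \<in> hom (cat M) ?w ?v" "amap K g = h" by auto
  have "amap K (g \<cdot>\<^bsub>cat M\<^esub> f) = amap K (Ide (cat M) ?v)" using f g h(2) by auto
  then have "g \<cdot>\<^bsub>cat M\<^esub> f = Ide (cat M) ?v" by (rule faithful[rotated 2]) (use f g in auto)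
  moreover have "amap K (f \<cdot>\<^bsub>cat M\<^esub> g) = amap K (Ide (cat M) ?w)" using f g h(3) by auto
  then have "f \<cdot>\<^bsub>cat M\<^esub> g = Ide (cat M) ?w" by (rule faithful[rotated 2]) (use f g in auto)
  ultimately show ?thesis using f g(1) by (auto simp: isomorphism_def)
qed

lemma mono_fibration: "fibration (cat M) (cat D) K (mono_class (cat D) B (to_base D))"
  unfolding fibration_def
proof (intro conjI ballI impI)
  show "is_functor (cat M) (cat D) K" by (rule K.is_functor_axioms)
  fix w f assume "w \<in> Obj (cat M)" "f \<in> mono_class (cat D) B (to_base D)"
    "f \<in> Arr (cat D) \<and> Cod (cat D) f = omap K w"
  then obtain g where "g \<in> Arr (cat M)" "Cod (cat M) g = w" "amap K g = f"
    using mono_arr_lift[of w f] by (auto simp: mono_class_def)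
  then show "\<exists>g. Cod (cat M) g = w \<and> cartesian_over (cat M) (cat D) K g f"
    using arr_cartesian by blast
qed

lemma K_discrete_isofibration: "discrete_isofibration (cat M) (cat D) K"
proof -
  have unique_lift: "\<exists>!g. isomorphism (cat M) g \<and> Cod (cat M) g = w \<and> amap K g = f"
    if w: "w \<in> Obj (cat M)" and f: "isomorphism (cat D) f" "Cod (cat D) f = omap K w" for w f
  proof -
    obtain g where g: "g \<in> Arr (cat M)" "Cod (cat M) g = w" "amap K g = f"
      by (rule iso_arr_lift[OF w f])
    have "isomorphism (cat M) g" using isomorphism_reflect[OF g(1)] g(3) f(1) by simp
    moreover have "g' = g" if g': "g' \<in> Arr (cat M)" "Cod (cat M) g' = w" "amap K g' = f" for g'
    proof -
      have "omap K (Dom (cat M) g') = omap K (Dom (cat M) g)"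
        using K.amap_arr(2)[OF g(1)] K.amap_arr(2)[OF g'(1)] g(3) g'(3) by simp
      then have "Dom (cat M) g' = Dom (cat M) g" by (rule injective[rotated 2]) (use g(1) g'(1) in auto)
      then show ?thesis
        using faithful[of g' "Dom (cat M) g" w g] g g' by simp
    qed
    moreover have "g' \<in> Arr (cat M)" if "isomorphism (cat M) g'" for g'
      using that by (simp add: isomorphism_def)
    ultimately show ?thesis using g(2,3) by (intro ex1I[of _ g]) blast+
  qed
  then show ?thesis
    unfolding discrete_isofibration_def isofibration_def
    using K.is_functor_axioms ex1_implies_ex[OF unique_lift] by (intro conjI ballI allI impI) blast+
qed

lemma full_image_eq: "strict_image (cat M) (cat D) K = full_image (cat M) (cat D) K"
proof -
  have "amap K ` Arr (cat M) = {f \<in> Arr (cat D). Dom (cat D) f \<in> omap K ` Obj (cat M) \<and>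
      Cod (cat D) f \<in> omap K ` Obj (cat M)}" (is "_ = ?F")
  proof
    show "amap K ` Arr (cat M) \<subseteq> ?F" by auto
    show "?F \<subseteq> amap K ` Arr (cat M)"
    proof
      fix f assume "f \<in> ?F"
      then obtain v w where vw: "v \<in> Obj (cat M)" "w \<in> Obj (cat M)"
        and f: "f \<in> hom (cat D) (omap K v) (omap K w)" by auto
      from full[OF vw f] show "f \<in> amap K ` Arr (cat M)" by auto
    qed
  qed
  then show ?thesis by (simp add: strict_image_def full_image_def full_subcategory_def)
qed

lemma ess_image_eq: "ess_image (cat M) (cat D) K = full_image (cat M) (cat D) K"
proof -
  have "{d \<in> Obj (cat D). \<exists>c \<in> Obj (cat M). isomorphic (cat D) d (omap K c)} = omap K ` Obj (cat M)"
    (is "?E = _")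
  proof
    show "?E \<subseteq> omap K ` Obj (cat M)"
    proof
      fix d assume "d \<in> ?E"
      then obtain w f where w: "w \<in> Obj (cat M)" and f: "isomorphism (cat D) f" "Cod (cat D) f = omap K w"
        and d: "Dom (cat D) f = d" by (auto simp: isomorphic_def)
      obtain g where "g \<in> Arr (cat M)" "amap K g = f" by (rule iso_arr_lift[OF w f])
      then show "d \<in> omap K ` Obj (cat M)" using d by auto
    qed
    have "isomorphic (cat D) (omap K c) (omap K c)" if "c \<in> Obj (cat M)" for c
      unfolding isomorphic_def isomorphism_def using that
      by (intro bexI[of _ "Ide (cat D) (omap K c)"] conjI) auto
    then show "omap K ` Obj (cat M) \<subseteq> ?E" by auto
  qed
  then show ?thesis by (simp add: ess_image_def full_image_def)
qed

end

subsection \<open>Passage to the next stage\<close>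

lemma next_Lam_omap:
  "omap (next_Lam A B S M D K) x = Str (omap K (underlying x))
     (BaseArr (amap (to_base M) (strmap x) \<cdot>\<^bsub>B\<^esub> amap (radj S) (lam A M D K (underlying x))))"
  by (simp add: next_Lam_def Let_def)

lemma next_Lam_simps [simp]:
  "underlying (omap (next_Lam A B S M D K) x) = omap K (underlying x)"
  "strmap (omap (next_Lam A B S M D K) x) =
     BaseArr (amap (to_base M) (strmap x) \<cdot>\<^bsub>B\<^esub> amap (radj S) (lam A M D K (underlying x)))"
  "amap (next_Lam A B S M D K) f =
     Mor (omap (next_Lam A B S M D K) (src f)) (amap K (under f)) (omap (next_Lam A B S M D K) (tgt f))"
  by (simp_all add: next_Lam_def Let_def)

locale tower_step = tower_comparison A B S M D K
  for A :: "('ao, 'am) category" and B :: "('o, 'm) category" and S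
    and M :: "('ao, 'am, 'o, 'm) stage" and D :: "('ao, 'am, 'o, 'm) decomp_stage" and K +
  fixes coeq :: "'am \<Rightarrow> 'am \<Rightarrow> 'am"
  assumes coeq: "chosen_coequalizers A coeq"
begin

sublocale D': structured_step A B S "cat D" "adj D" "to_base D" "quot D" untag_arr
    "Obj (decomp_category B S D)" "\<lambda>a. BaseArr (amap (radj S) (counit (adj D) a))"
    "decomp_coeq A coeq S D"
  by (rule structured_step_decomp) (rule high.stage_over_axioms coeq)+

sublocale M': structured_step A "cat M" "adj M" "cat M" "adj M" fident
    "\<lambda>x. Ide A (omap (ladj (adj M)) x)" "\<lambda>b. b"
    "Obj (eilenberg_moore (cat M) (induced_monad (adj M)))"
    "\<lambda>a. amap (radj (adj M)) (counit (adj M) a)" "monadic_coeq coeq (adj M)"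
  by (rule structured_step_monadic) (rule low.adjunction_axioms coeq)+

abbreviation M1 where "M1 \<equiv> next_monadic_stage A coeq M"
abbreviation D1 where "D1 \<equiv> next_decomp_stage A coeq B S D"
abbreviation K1 where "K1 \<equiv> next_Lam A B S M D K"

lemma D'_cat: "D'.C' = decomp_category B S D"
  using decomp_category_eq[of B S D] by simp

lemma M'_cat: "M'.C' = eilenberg_moore (cat M) (induced_monad (adj M))"
  using eilenberg_moore_eq[of "cat M" "adj M"] by simp

abbreviation X\<^sub>M where "X\<^sub>M \<equiv> Obj (eilenberg_moore (cat M) (induced_monad (adj M)))"
abbreviation X\<^sub>D where "X\<^sub>D \<equiv> Obj (decomp_category B S D)"

lemma K1_obj: assumes "x \<in> X\<^sub>M" shows "omap K1 x \<in> X\<^sub>D"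
proof -
  obtain v m where x: "x = Str v m" "v \<in> Obj (cat M)"
    "m \<in> hom (cat M) (omap (radj (adj M)) (omap (ladj (adj M)) v)) v"
    using assms by (auto simp: eilenberg_moore_obj_iff)
  then have "omap K v \<in> Obj (cat D)" "amap (to_base M) m \<cdot>\<^bsub>B\<^esub> amap (radj S) (l v) \<in>
      hom B (omap (radj S) (omap (ladj (adj D)) (omap K v))) (omap (to_base D) (omap K v))"
    by auto
  then show ?thesis using x by (auto simp: decomp_obj_iff next_Lam_omap)
qed

text \<open>By naturality of \<open>\<lambda>\<close> the two sides of the condition in the adjoint decomposition are the
  images in \<open>B\<close> of the two sides of the condition for algebras, precomposed with the isomorphism
  \<open>R \<lambda>\<close>. Cancelling it, and then the faithful functor to \<open>B\<close>, gives the converse, which is the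
  source of fullness at the next stage.\<close>

lemma K1_comm_iff:
  assumes xy: "x \<in> X\<^sub>M" "y \<in> X\<^sub>M" and f: "f \<in> hom (cat M) (underlying x) (underlying y)"
  shows "D'.comm (omap K1 x) (amap K f) (omap K1 y) \<longleftrightarrow> M'.comm x f y"
proof -
  let ?v = "underlying x" and ?w = "underlying y"
  let ?U = "to_base M" and ?R = "radj S" and ?L = "ladj (adj M)" and ?RM = "radj (adj M)"
  have f': "f \<in> Arr (cat M)" "Dom (cat M) f = ?v" "Cod (cat M) f = ?w" using f by auto
  have v: "?v \<in> Obj (cat M)" "?w \<in> Obj (cat M)" using xy by auto
  have 1: "amap (to_base D) (amap K f) \<cdot>\<^bsub>B\<^esub> untag_arr (strmap (omap K1 x)) =
      amap ?U (f \<cdot>\<^bsub>cat M\<^esub> strmap x) \<cdot>\<^bsub>B\<^esub> amap ?R (l ?v)"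
    using xy f' v by simp
  have "untag_arr (strmap (omap K1 y)) \<cdot>\<^bsub>B\<^esub> amap ?R (amap (ladj (adj D)) (amap K f)) =
      amap ?U (strmap y) \<cdot>\<^bsub>B\<^esub> amap ?R (l ?w \<cdot>\<^bsub>A\<^esub> amap (ladj (adj D)) (amap K f))"
    using xy f' v by simp
  also have "\<dots> = amap ?U (strmap y \<cdot>\<^bsub>cat M\<^esub> amap ?RM (amap ?L f)) \<cdot>\<^bsub>B\<^esub> amap ?R (l ?v)"
    unfolding lam_naturality[OF f] using xy f' v by simp
  finally have 2: "untag_arr (strmap (omap K1 y)) \<cdot>\<^bsub>B\<^esub> amap ?R (amap (ladj (adj D)) (amap K f)) =
      amap ?U (strmap y \<cdot>\<^bsub>cat M\<^esub> amap ?RM (amap ?L f)) \<cdot>\<^bsub>B\<^esub> amap ?R (l ?v)" .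
  show ?thesis
  proof
    assume "D'.comm (omap K1 x) (amap K f) (omap K1 y)"
    then have "amap ?U (f \<cdot>\<^bsub>cat M\<^esub> strmap x) \<cdot>\<^bsub>B\<^esub> amap ?R (l ?v) =
        amap ?U (strmap y \<cdot>\<^bsub>cat M\<^esub> amap ?RM (amap ?L f)) \<cdot>\<^bsub>B\<^esub> amap ?R (l ?v)"
      by (simp only: 1 2)
    then have "amap ?U (f \<cdot>\<^bsub>cat M\<^esub> strmap x) = amap ?U (strmap y \<cdot>\<^bsub>cat M\<^esub> amap ?RM (amap ?L f))"
      by (rule high.base.left.dom.isomorphism_cancel_right[OF radj_lam_isomorphism[OF v(1)], rotated -1])
        (use xy f' v in simp_all)
    then have "f \<cdot>\<^bsub>cat M\<^esub> strmap x = strmap y \<cdot>\<^bsub>cat M\<^esub> amap ?RM (amap ?L f)"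
      by (rule base_faithful[rotated 2]) (use xy f' in simp_all)
    then show "M'.comm x f y" by simp
  next
    assume "M'.comm x f y"
    then have "f \<cdot>\<^bsub>cat M\<^esub> strmap x = strmap y \<cdot>\<^bsub>cat M\<^esub> amap ?RM (amap ?L f)" by simp
    then show "D'.comm (omap K1 x) (amap K f) (omap K1 y)" by (simp only: 1 2)
  qed
qed


lemma K1_functor: "is_functor M'.C' D'.C' K1"
proof unfold_locales
  fix x assume "x \<in> Obj M'.C'"
  then show "omap K1 x \<in> Obj D'.C'" using K1_obj[of x] by simp
next
  fix f x y assume f: "f \<in> hom M'.C' x y"
  then have xy: "x \<in> X\<^sub>M" "y \<in> X\<^sub>M" "src f = x" "tgt f = y"
    and u: "under f \<in> hom (cat M) (underlying x) (underlying y)" and c: "M'.comm x (under f) y"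
    by auto
  have "D'.comm (omap K1 x) (amap K (under f)) (omap K1 y)"
    by (rule K1_comm_iff[OF xy(1,2) u, THEN iffD2]) (rule c)
  then show "amap K1 f \<in> hom D'.C' (omap K1 x) (omap K1 y)"
    using xy u K1_obj[OF xy(1)] K1_obj[OF xy(2)] by auto
next
  fix x assume "x \<in> Obj M'.C'"
  then show "amap K1 (Ide M'.C' x) = Ide D'.C' (omap K1 x)" by simp
next
  fix f x y g z assume f: "f \<in> hom M'.C' x y" and g: "g \<in> hom M'.C' y z"
  have "amap K (under g \<cdot>\<^bsub>cat M\<^esub> under f) = amap K (under g) \<cdot>\<^bsub>cat D\<^esub> amap K (under f)"
    by (rule K.amap_comp_eq) (use f g in auto)
  then show "amap K1 (g \<cdot>\<^bsub>M'.C'\<^esub> f) = amap K1 g \<cdot>\<^bsub>D'.C'\<^esub> amap K1 f"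
    by simp
qed

lemma K1_full:
  assumes vw: "v \<in> X\<^sub>M" "w \<in> X\<^sub>M" and g: "g \<in> hom D'.C' (omap K1 v) (omap K1 w)"
  shows "\<exists>f \<in> hom M'.C' v w. amap K1 f = g"
proof -
  have g': "g = Mor (omap K1 v) (under g) (omap K1 w)"
    "under g \<in> hom (cat D) (omap K (underlying v)) (omap K (underlying w))"
    "D'.comm (omap K1 v) (under g) (omap K1 w)" using g by auto
  obtain f where f: "f \<in> hom (cat M) (underlying v) (underlying w)" "amap K f = under g"
    using full[OF _ _ g'(2)] vw by auto
  have "M'.comm v f w"
    by (rule K1_comm_iff[OF vw f(1), THEN iffD1]) (use g'(3) in \<open>simp only: f(2)\<close>)
  then have "Mor v f w \<in> hom M'.C' v w" using vw f(1) by simp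
  moreover have "amap K1 (Mor v f w) = g" by (subst g'(1)) (simp add: f(2))
  ultimately show ?thesis by blast
qed

lemma K1_faithful:
  assumes f: "f \<in> hom M'.C' v w" and g: "g \<in> hom M'.C' v w" and eq: "amap K1 f = amap K1 g"
  shows "f = g"
proof -
  have fg: "f = Mor v (under f) w" "under f \<in> hom (cat M) (underlying v) (underlying w)"
    "g = Mor v (under g) w" "under g \<in> hom (cat M) (underlying v) (underlying w)"
    using f g by auto
  have "amap K (under f) = amap K (under g)" using eq by simp
  then have "under f = under g" by (rule faithful[OF fg(2,4)])
  then show ?thesis using fg(1,3) by metis
qed

text \<open>The structure map of an algebra is recovered from that of its image because \<open>R \<lambda>\<close> is
  invertible and the functor to \<open>B\<close> is faithful.\<close>

lemma K1_injective:
  assumes vw: "v \<in> X\<^sub>M" "w \<in> X\<^sub>M" and eq: "omap K1 v = omap K1 w"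
  shows "v = w"
proof -
  obtain x m where v: "v = Str x m" and x: "x \<in> Obj (cat M)"
    and m: "m \<in> hom (cat M) (omap (radj (adj M)) (omap (ladj (adj M)) x)) x"
    using vw(1) by (auto simp: eilenberg_moore_obj_iff)
  obtain y n where w: "w = Str y n" and y: "y \<in> Obj (cat M)"
    and n: "n \<in> hom (cat M) (omap (radj (adj M)) (omap (ladj (adj M)) y)) y"
    using vw(2) by (auto simp: eilenberg_moore_obj_iff)
  have "omap K x = omap K y" using eq by (simp add: next_Lam_omap v w)
  then have xy: "y = x" by (rule injective[OF x y, symmetric])
  have "amap (to_base M) m \<cdot>\<^bsub>B\<^esub> amap (radj S) (l x) = amap (to_base M) n \<cdot>\<^bsub>B\<^esub> amap (radj S) (l x)"
    using eq by (simp add: next_Lam_omap v w xy)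
  then have "amap (to_base M) m = amap (to_base M) n"
    by (rule high.base.left.dom.isomorphism_cancel_right[OF radj_lam_isomorphism[OF x], rotated -1])
      (use m n x xy in auto)
  then have "m = n" by (rule base_faithful[OF m n[unfolded xy]])
  then show ?thesis using v w xy by simp
qed

text \<open>The arrow \<open>k\<close> lifted at the current stage satisfies \<open>f \<cdot> k = g\<close> and respects the structure
  maps after composition with \<open>f\<close>; as \<open>f\<close> is monic, it is an arrow of algebras.\<close>

lemma next_mono_lift:
  assumes f: "f \<in> hom M'.C' v w" and mono: "monomorphism B (amap (to_base M) (under f))"
    and g: "g \<in> hom M'.C' u w"
    and h: "h \<in> hom B (omap (to_base M) (underlying u)) (omap (to_base M) (underlying v))"
    and eq: "amap (to_base M) (under f) \<cdot>\<^bsub>B\<^esub> h = amap (to_base M) (under g)"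
  shows "\<exists>k \<in> hom M'.C' u v. amap (to_base M) (under k) = h"
proof -
  let ?R = "radj (adj M)" and ?L = "ladj (adj M)"
  let ?f = "under f" and ?g = "under g"
  have uvw: "u \<in> X\<^sub>M" "v \<in> X\<^sub>M" "w \<in> X\<^sub>M" using f g by auto
  have f': "?f \<in> hom (cat M) (underlying v) (underlying w)"
    and cf: "?f \<cdot>\<^bsub>cat M\<^esub> strmap v = strmap w \<cdot>\<^bsub>cat M\<^esub> amap ?R (amap ?L ?f)" using f by auto
  have g': "?g \<in> hom (cat M) (underlying u) (underlying w)"
    and cg: "?g \<cdot>\<^bsub>cat M\<^esub> strmap u = strmap w \<cdot>\<^bsub>cat M\<^esub> amap ?R (amap ?L ?g)" using g by auto
  obtain k where k: "k \<in> hom (cat M) (underlying u) (underlying v)" and kh: "amap (to_base M) k = h"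
    using mono_lift[OF f' mono g' h eq] by auto
  have "amap (to_base M) (?f \<cdot>\<^bsub>cat M\<^esub> k) = amap (to_base M) ?g"
    using f' k by (simp add: kh eq)
  then have fk: "?f \<cdot>\<^bsub>cat M\<^esub> k = ?g" by (rule base_faithful[rotated 2]) (use f' g' k in auto)
  have "?f \<cdot>\<^bsub>cat M\<^esub> (k \<cdot>\<^bsub>cat M\<^esub> strmap u) = (?f \<cdot>\<^bsub>cat M\<^esub> k) \<cdot>\<^bsub>cat M\<^esub> strmap u"
    using f' k uvw by simp
  also have "\<dots> = strmap w \<cdot>\<^bsub>cat M\<^esub> amap ?R (amap ?L (?f \<cdot>\<^bsub>cat M\<^esub> k))"
    by (simp only: fk cg)
  also have "\<dots> = strmap w \<cdot>\<^bsub>cat M\<^esub> (amap ?R (amap ?L ?f) \<cdot>\<^bsub>cat M\<^esub> amap ?R (amap ?L k))"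
    using f' k by simp
  also have "\<dots> = ?f \<cdot>\<^bsub>cat M\<^esub> (strmap v \<cdot>\<^bsub>cat M\<^esub> amap ?R (amap ?L k))"
    by (rule low.left.dom.comp_eq_extend[OF cf[symmetric]]) (use f' k uvw in auto)
  finally have "k \<cdot>\<^bsub>cat M\<^esub> strmap u = strmap v \<cdot>\<^bsub>cat M\<^esub> amap ?R (amap ?L k)"
    by (rule base_mono_cancel[OF _ mono, rotated -1]) (use f' k uvw in auto)
  then have "Mor u k v \<in> hom M'.C' u v" using k uvw by simp
  then show ?thesis using kh by (intro bexI[of _ "Mor u k v"]) simp_all
qed

text \<open>The central step. The structure map on \<open>d\<close> lives in \<open>B\<close> only; the monomorphism into the
  image of an algebra \<open>w\<close> lifts it to the monadic tower, where the laws of \<open>w\<close> force it to be an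
  algebra structure.\<close>

lemma next_mono_closed:
  assumes w: "w \<in> X\<^sub>M" and f: "f \<in> hom D'.C' d (omap K1 w)"
    and mono: "monomorphism B (amap (to_base D) (under f))"
  shows "d \<in> omap K1 ` X\<^sub>M"
proof -
  let ?R = "radj (adj M)" and ?L = "ladj (adj M)" and ?e = "counit (adj M)"
  let ?U = "to_base M" and ?w = "underlying w" and ?m = "strmap w" and ?b = "untag_arr (strmap d)"
  have d: "d \<in> X\<^sub>D" "d = Str (underlying d) (BaseArr ?b)"
    using f by (auto simp: decomp_obj_iff)
  have u: "under f \<in> hom (cat D) (underlying d) (omap K ?w)"
    and comm: "amap (to_base D) (under f) \<cdot>\<^bsub>B\<^esub> ?b =
      (amap ?U ?m \<cdot>\<^bsub>B\<^esub> amap (radj S) (l ?w)) \<cdot>\<^bsub>B\<^esub> amap (radj S) (amap (ladj (adj D)) (under f))"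
    using f by auto
  have w': "?w \<in> Obj (cat M)" using w by simp
  obtain v where v: "v \<in> Obj (cat M)" "underlying d = omap K v"
    using mono_closed[OF w' u mono] by auto
  have "under f \<in> hom (cat D) (omap K v) (omap K ?w)" using u v(2) by simp
  from full[OF v(1) w' this]
  obtain g where g: "g \<in> hom (cat M) v ?w" "amap K g = under f" by blast
  have g': "g \<in> Arr (cat M)" "Dom (cat M) g = v" "Cod (cat M) g = ?w" using g by auto
  have base_g: "amap (to_base D) (under f) = amap ?U g" using g'(1) g(2)[symmetric] by simp
  have mono_g: "monomorphism B (amap ?U g)" using mono base_g by simp
  obtain t where t: "t \<in> Arr B" "Dom B t = omap (radj S) (omap ?L v)"
      "Cod B t = omap (radj S) (omap (ladj (adj D)) (omap K v))"
    and lt: "amap (radj S) (l v) \<cdot>\<^bsub>B\<^esub> t = Ide B (omap (radj S) (omap ?L v))"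
    and tl: "t \<cdot>\<^bsub>B\<^esub> amap (radj S) (l v) = Ide B (omap (radj S) (omap (ladj (adj D)) (omap K v)))"
    using radj_lam_isomorphism[OF v(1)] v(1) by (auto simp: isomorphism_def)
  have b: "?b \<in> Arr B" "Dom B ?b = omap (radj S) (omap (ladj (adj D)) (omap K v))"
    "Cod B ?b = omap ?U v" using D'.dec_arr[OF d(1)] v by simp_all
  \<comment> \<open>The transported structure map \<open>b \<cdot> t\<close>, followed by \<open>U g\<close>, comes from an arrow over \<open>B\<close>.\<close>
  have "amap ?U g \<cdot>\<^bsub>B\<^esub> (?b \<cdot>\<^bsub>B\<^esub> t) = (amap ?U g \<cdot>\<^bsub>B\<^esub> ?b) \<cdot>\<^bsub>B\<^esub> t"
    using g' b t by simp
  also have "\<dots> = ((amap ?U ?m \<cdot>\<^bsub>B\<^esub> amap (radj S) (l ?w)) \<cdot>\<^bsub>B\<^esub>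
      amap (radj S) (amap (ladj (adj D)) (amap K g))) \<cdot>\<^bsub>B\<^esub> t"
    using comm by (simp only: base_g g(2))
  also have "\<dots> = (amap ?U ?m \<cdot>\<^bsub>B\<^esub> amap (radj S) (l ?w \<cdot>\<^bsub>A\<^esub> amap (ladj (adj D)) (amap K g))) \<cdot>\<^bsub>B\<^esub> t"
    using g' t v(1) w by simp
  also have "\<dots> = amap ?U ?m \<cdot>\<^bsub>B\<^esub> (amap (radj S) (amap ?L g) \<cdot>\<^bsub>B\<^esub> (amap (radj S) (l v) \<cdot>\<^bsub>B\<^esub> t))"
    unfolding lam_naturality[OF g(1)] using g' t v(1) w by simp
  also have "\<dots> = amap ?U (?m \<cdot>\<^bsub>cat M\<^esub> amap ?R (amap ?L g))"
    using g' v(1) w by (simp add: lt)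
  finally have g_bt: "amap ?U g \<cdot>\<^bsub>B\<^esub> (?b \<cdot>\<^bsub>B\<^esub> t) = amap ?U (?m \<cdot>\<^bsub>cat M\<^esub> amap ?R (amap ?L g))" .
  then obtain n where n: "n \<in> hom (cat M) (omap ?R (omap ?L v)) v" "amap ?U n = ?b \<cdot>\<^bsub>B\<^esub> t"
    using mono_lift[OF g(1) mono_g, of "?m \<cdot>\<^bsub>cat M\<^esub> amap ?R (amap ?L g)" "omap ?R (omap ?L v)" "?b \<cdot>\<^bsub>B\<^esub> t"]
      g' b t v(1) w by auto
  have n': "n \<in> Arr (cat M)" "Dom (cat M) n = omap ?R (omap ?L v)" "Cod (cat M) n = v"
    using n(1) by auto
  have "amap ?U (g \<cdot>\<^bsub>cat M\<^esub> n) = amap ?U g \<cdot>\<^bsub>B\<^esub> amap ?U n"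
    by (rule V.amap_comp_eq) (use g' n' in simp_all)
  also have "\<dots> = amap ?U (?m \<cdot>\<^bsub>cat M\<^esub> amap ?R (amap ?L g))"
    by (simp only: n(2) g_bt)
  finally have gn: "g \<cdot>\<^bsub>cat M\<^esub> n = ?m \<cdot>\<^bsub>cat M\<^esub> amap ?R (amap ?L g)"
    by (rule base_faithful[of _ "omap ?R (omap ?L v)" ?w, rotated 2]) (use g' n' v(1) w in simp_all)
  \<comment> \<open>The algebra laws for \<open>n\<close> hold after composing with \<open>g\<close>, by those for the structure map of \<open>w\<close>.\<close>
  note m_unit = eilenberg_moore_laws(1)[OF w] and m_assoc = eilenberg_moore_laws(2)[OF w]
  note C = low.left.dom.comp_eq_extend
  have "g \<cdot>\<^bsub>cat M\<^esub> (n \<cdot>\<^bsub>cat M\<^esub> unit (adj M) v) = ?m \<cdot>\<^bsub>cat M\<^esub> (amap ?R (amap ?L g) \<cdot>\<^bsub>cat M\<^esub> unit (adj M) v)"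
    by (rule C[OF gn]) (use g' n' v(1) w in simp_all)
  also have "amap ?R (amap ?L g) \<cdot>\<^bsub>cat M\<^esub> unit (adj M) v = unit (adj M) ?w \<cdot>\<^bsub>cat M\<^esub> g"
    using low.unit_naturality[OF g'(1)] g' by simp
  also have "?m \<cdot>\<^bsub>cat M\<^esub> \<dots> = (?m \<cdot>\<^bsub>cat M\<^esub> unit (adj M) ?w) \<cdot>\<^bsub>cat M\<^esub> g"
    using g' w by simp
  also have "\<dots> = g \<cdot>\<^bsub>cat M\<^esub> Ide (cat M) v"
    using g' by (simp add: m_unit)
  finally have n_unit: "n \<cdot>\<^bsub>cat M\<^esub> unit (adj M) v = Ide (cat M) v"
    by (rule base_mono_cancel[OF g'(1) mono_g, rotated -1]) (use g' n' v(1) in auto)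
  have "g \<cdot>\<^bsub>cat M\<^esub> (n \<cdot>\<^bsub>cat M\<^esub> amap ?R (amap ?L n)) =
      ?m \<cdot>\<^bsub>cat M\<^esub> (amap ?R (amap ?L g) \<cdot>\<^bsub>cat M\<^esub> amap ?R (amap ?L n))"
    by (rule C[OF gn]) (use g' n' v(1) w in simp_all)
  also have "amap ?R (amap ?L g) \<cdot>\<^bsub>cat M\<^esub> amap ?R (amap ?L n) = amap ?R (amap ?L (g \<cdot>\<^bsub>cat M\<^esub> n))"
    using g' n' by simp
  also have "\<dots> = amap ?R (amap ?L (?m \<cdot>\<^bsub>cat M\<^esub> amap ?R (amap ?L g)))"
    by (simp only: gn)
  also have "\<dots> = amap ?R (amap ?L ?m) \<cdot>\<^bsub>cat M\<^esub> amap ?R (amap ?L (amap ?R (amap ?L g)))"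
    using g' w by simp
  also have "?m \<cdot>\<^bsub>cat M\<^esub> \<dots> =
      ?m \<cdot>\<^bsub>cat M\<^esub> (amap ?R (?e (omap ?L ?w)) \<cdot>\<^bsub>cat M\<^esub> amap ?R (amap ?L (amap ?R (amap ?L g))))"
    by (rule C[OF m_assoc]) (use g' w in simp_all)
  also have "amap ?R (?e (omap ?L ?w)) \<cdot>\<^bsub>cat M\<^esub> amap ?R (amap ?L (amap ?R (amap ?L g))) =
      amap ?R (amap ?L g) \<cdot>\<^bsub>cat M\<^esub> amap ?R (?e (omap ?L v))"
    using arg_cong[OF low.counit_naturality[of "amap ?L g"], of "amap ?R"] g' v(1) w by simp
  also have "?m \<cdot>\<^bsub>cat M\<^esub> \<dots> = g \<cdot>\<^bsub>cat M\<^esub> (n \<cdot>\<^bsub>cat M\<^esub> amap ?R (?e (omap ?L v)))"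
    by (rule C[OF gn[symmetric]]) (use g' n' v(1) w in simp_all)
  finally have n_assoc: "n \<cdot>\<^bsub>cat M\<^esub> amap ?R (amap ?L n) = n \<cdot>\<^bsub>cat M\<^esub> amap ?R (?e (omap ?L v))"
    by (rule base_mono_cancel[OF g'(1) mono_g, rotated -1]) (use g' n' v(1) in auto)
  have "Str v n \<in> X\<^sub>M"
    using v(1) n(1) n_unit n_assoc by (simp add: eilenberg_moore_obj_iff)
  moreover have "(?b \<cdot>\<^bsub>B\<^esub> t) \<cdot>\<^bsub>B\<^esub> amap (radj S) (l v) = ?b"
    using b t v(1) by (simp add: tl)
  then have "omap K1 (Str v n) = d"
    using d(2) v(2) n(2) by (simp add: next_Lam_omap)
  ultimately show ?thesis by blast
qed


lemma K1_radj_obj: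
  assumes a: "a \<in> Obj A"
  shows "omap K1 (omap (radj M'.T') a) = omap (radj D'.T') a"
proof -
  have "amap (to_base M) (amap (radj (adj M)) (counit (adj M) a)) \<cdot>\<^bsub>B\<^esub>
      amap (radj S) (l (omap (radj (adj M)) a)) = amap (radj S) (counit (adj D) a)"
    using a arg_cong[OF counit_lam[OF a], of "amap (radj S)"] by simp
  then show ?thesis using a by (simp add: next_Lam_omap)
qed

theorem next_comparison: "tower_comparison A B S M1 D1 K1"
proof -
  have M1: "cat M1 = M'.C'" "to_base M1 = to_base M \<circ>\<^sub>F forget" "adj M1 = M'.T'"
    by (simp_all only: next_monadic_stage_simps M'_cat)
  have D1: "cat D1 = D'.C'" "to_base D1 = to_base D \<circ>\<^sub>F forget" "adj D1 = D'.T'"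
    "quot D1 = (\<lambda>x. decomp_coeq A coeq S D x \<cdot>\<^bsub>A\<^esub> quot D (underlying x))"
    by (simp_all add: D'_cat)
  show ?thesis
  proof (intro tower_comparison.intro tower_comparison_axioms.intro, unfold M1 D1)
    show "stage_over A B S D'.C' D'.T' (to_base D \<circ>\<^sub>F forget)
        (\<lambda>x. decomp_coeq A coeq S D x \<cdot>\<^bsub>A\<^esub> quot D (underlying x))"
      by (rule D'.next_stage_over)
    show "adjunction A M'.C' M'.T'" by (rule M'.next_adjunction)
    show "is_functor M'.C' B (to_base M \<circ>\<^sub>F forget)"
      by (rule is_functor_fcomp[OF M'.forget.is_functor_axioms V.is_functor_axioms])
    show "is_functor M'.C' D'.C' K1" by (rule K1_functor)
  next
    fix v w g assume "v \<in> Obj M'.C'" "w \<in> Obj M'.C'" "g \<in> hom D'.C' (omap K1 v) (omap K1 w)"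
    then show "\<exists>f \<in> hom M'.C' v w. amap K1 f = g"
      unfolding structured_category_simps(1) by (rule K1_full)
  next
    fix f v w g assume "f \<in> hom M'.C' v w" "g \<in> hom M'.C' v w" "amap K1 f = amap K1 g"
    then show "f = g" by (rule K1_faithful)
  next
    fix v w assume "v \<in> Obj M'.C'" "w \<in> Obj M'.C'" "omap K1 v = omap K1 w"
    then show "v = w" unfolding structured_category_simps(1) by (rule K1_injective)
  next
    fix a assume "a \<in> Obj A"
    then show "omap K1 (omap (radj M'.T') a) = omap (radj D'.T') a" by (rule K1_radj_obj)
  next
    fix e assume "e \<in> Arr A"
    then show "amap K1 (amap (radj M'.T') e) = amap (radj D'.T') e"
      using K1_radj_obj[of "Dom A e"] K1_radj_obj[of "Cod A e"] by simp
  next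
    fix v assume "v \<in> Obj M'.C'"
    then show "omap (to_base D \<circ>\<^sub>F forget) (omap K1 v) = omap (to_base M \<circ>\<^sub>F forget) v" by simp
  next
    fix f assume "f \<in> Arr M'.C'"
    then show "amap (to_base D \<circ>\<^sub>F forget) (amap K1 f) = amap (to_base M \<circ>\<^sub>F forget) f" by simp
  next
    fix f v w g assume f: "f \<in> hom M'.C' v w" and g: "g \<in> hom M'.C' v w"
      and "amap (to_base M \<circ>\<^sub>F forget) f = amap (to_base M \<circ>\<^sub>F forget) g"
    then have "amap (to_base M) (under f) = amap (to_base M) (under g)" by simp
    then have "under f = under g" by (rule base_faithful[rotated 2]) (use f g in auto)
    then show "f = g" using f g by auto
  next
    fix f v w g u h assume "f \<in> hom M'.C' v w" "monomorphism B (amap (to_base M \<circ>\<^sub>F forget) f)"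
      "g \<in> hom M'.C' u w" "h \<in> hom B (omap (to_base M \<circ>\<^sub>F forget) u) (omap (to_base M \<circ>\<^sub>F forget) v)"
      "amap (to_base M \<circ>\<^sub>F forget) f \<cdot>\<^bsub>B\<^esub> h = amap (to_base M \<circ>\<^sub>F forget) g"
    then show "\<exists>k \<in> hom M'.C' u v. amap (to_base M \<circ>\<^sub>F forget) k = h"
      using next_mono_lift unfolding fcomp_simps forget_simps by blast
  next
    fix w f d assume "w \<in> Obj M'.C'" "f \<in> hom D'.C' d (omap K1 w)"
      "monomorphism B (amap (to_base D \<circ>\<^sub>F forget) f)"
    then show "d \<in> omap K1 ` Obj M'.C'"
      using next_mono_closed unfolding fcomp_simps forget_simps structured_category_simps by blast
  qed
qed

end

lemma tower_comparison_zero: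
  assumes "adjunction A B S"
  shows "tower_comparison A B S (monadic_tower A coeq B S 0) (decomp A coeq B S 0) (Lam A coeq B S 0)"
proof -
  interpret T: stage_over A B S "tagged_category B" "tagged_adjn S" untag
    "\<lambda>x. Ide A (omap (ladj S) (untag_obj x))"
    by (rule stage_over_tagged) fact
  interpret I: is_functor "tagged_category B" "tagged_category B" fident
    by (rule is_functor_fident) (rule T.stage.left.dom.category_axioms)
  show ?thesis
    unfolding monadic_tower.simps(1) decomp.simps(1) Lam.simps(1)
  proof (intro tower_comparison.intro tower_comparison_axioms.intro, unfold stage.simps decomp_stage.simps)
    fix f v w g u h
    assume "f \<in> hom (tagged_category B) v w" "g \<in> hom (tagged_category B) u w"
      "h \<in> hom B (omap untag u) (omap untag v)"
    then have "BaseArr h \<in> hom (tagged_category B) u v" by auto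
    then show "\<exists>k \<in> hom (tagged_category B) u v. amap untag k = h"
      by (intro bexI[of _ "BaseArr h"]) simp_all
  qed (auto intro: T.stage_over_axioms T.stage.adjunction_axioms T.U.is_functor_axioms I.is_functor_axioms)
qed

theorem tower_comparison_stage:
  assumes "adjunction A B S" and coeq: "chosen_coequalizers A coeq"
  shows "tower_comparison A B S (monadic_tower A coeq B S n) (decomp A coeq B S n) (Lam A coeq B S n)"
proof (induction n)
  case 0
  show ?case by (rule tower_comparison_zero) fact
next
  case (Suc n)
  then interpret tower_step A B S "monadic_tower A coeq B S n" "decomp A coeq B S n"
    "Lam A coeq B S n" coeq
    by (intro tower_step.intro tower_step_axioms.intro coeq)
  show ?case using next_comparison by simp
qed

theorem theorem4p19:
  fixes A :: "('ao, 'am) category" and B :: "('bo, 'bm) category"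
    and S :: "('ao, 'am, 'bo, 'bm) adjn"
    and coeq :: "'am \<Rightarrow> 'am \<Rightarrow> 'am" and n :: nat
  assumes "category A" and "category B"
    and "chosen_coequalizers A coeq"
    and "adjunction A B S"
  shows "let \<B>\<^sub>n = cat (monadic_tower A coeq B S n);
             \<D>\<^sub>n = cat (decomp A coeq B S n);
             U\<^sub>n = to_base (decomp A coeq B S n);
             \<Lambda>\<^sub>n = Lam A coeq B S n
         in fibration \<B>\<^sub>n \<D>\<^sub>n \<Lambda>\<^sub>n (mono_class \<D>\<^sub>n B U\<^sub>n)
          \<and> discrete_isofibration \<B>\<^sub>n \<D>\<^sub>n \<Lambda>\<^sub>n
          \<and> ess_image \<B>\<^sub>n \<D>\<^sub>n \<Lambda>\<^sub>n = strict_image \<B>\<^sub>n \<D>\<^sub>n \<Lambda>\<^sub>n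
          \<and> strict_image \<B>\<^sub>n \<D>\<^sub>n \<Lambda>\<^sub>n = full_image \<B>\<^sub>n \<D>\<^sub>n \<Lambda>\<^sub>n"
proof -
  interpret tower_comparison A B S "monadic_tower A coeq B S n" "decomp A coeq B S n" "Lam A coeq B S n"
    by (rule tower_comparison_stage) fact+
  show ?thesis
    unfolding Let_def
    using mono_fibration K_discrete_isofibration ess_image_eq full_image_eq by simp
qed

end
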